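(* \begin{align*} \xi_1^{\equiv4(32)}&=3\cdot2^{-2s}(\xi_5-2^{-4s}\xi_1),\\ (\xi_1^\vee)^{\cong-20(32)}&=3\cdot2^{-2s}(\xi_4^\vee-2^{-4s}\xi_1^\vee),\\ \xi_1^{\equiv20(32)}&=(\xi_4-\xi_2-\xi_5+2^{1-4s}\xi_1)+2^{-4s}(\xi_1-\xi_4-2\xi_3+4\xi_5)\\ &\qquad-2^{-2s}(\xi_1-\xi_3-2\xi_2+5\cdot2^{-4s}\xi_1),\\ (\xi_1^\vee)^{\cong-4(32)}&=(\xi_5^\vee-\xi_3^\vee-\xi_4^\vee+2^{1-4s}\xi_1^\vee)+2^{-4s}(\xi_1^\vee-\xi_5^\vee-2\xi_2^\vee+4\xi_4^\vee)\\ &\qquad-2^{-2s}(\xi_1^\vee-\xi_2^\vee-2\xi_3^\vee+5\cdot2^{-4s}\xi_1^\vee). \end{align*}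
   Context: Binary cubic forms $au^3+bu^2v+cuv^2+dv^3$ are identified with $(a,b,c,d)$, with discriminant $P(x)=b^2c^2+18abcd-4ac^3-4b^3d-27a^2d^2$ and $\mathrm{SL}_2(\mathbb{Z})$ acting by linear change of variables. Lattices: $L_1=\mathbb{Z}^4$, $L_2=\{(a,b,c,d)\in L_1: a+b+d,\ a+c+d\in 2\mathbb{Z}\}$, $L_3=\{(a,b,c,d)\in L_1: a+b+c,\ b+c+d\in 2\mathbb{Z}\}$, $L_4=\{(a,b,c,d)\in L_1: b+c\in 2\mathbb{Z}\}$, $L_5=\{(a,b,c,d)\in L_1: a,d,b+c\in 2\mathbb{Z}\}$, $L_1^\vee=\{(a,b,c,d): a,d\in\mathbb{Z},\ b,c\in3\mathbb{Z}\}$, $L_2^\vee=L_1^\vee\cap L_3$, $L_3^\vee=L_1^\vee\cap L_2$, $L_4^\vee=L_1^\vee\cap L_5$, $L_5^\vee=L_1^\vee\cap L_4$. For a subset $X$ of a lattice stable under $\mathrm{SL}_2(\mathbb{Z})$, write $\xi(X)$ for the vector $(\xi_1(X),\xi_2(X))^T$ with $\xi_j(X)=\sum_{x\in \mathrm{SL}_2(\mathbb{Z})\backslash X,\ (-1)^{j-1}P(x)>0}|\mathrm{Stab}(x)|^{-1}|P(x)|^{-s}$. Put $\xi_i=\xi(L_i)$, $\xi_i^\vee=3^{3s}\xi(L_i^\vee)$ (i.e. the same sum with $|P(x)/27|^{-s}$). Put $L_1^{\equiv l(N)}=\{x\in L_1: P(x)\equiv l\bmod N\}$, $(L_1^\vee)^{\cong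 l(N)}=\{x\in L_1^\vee: P(x)/27\equiv l\bmod N\}$, $\xi_1^{\equiv l(N)}=\xi(L_1^{\equiv l(N)})$ and $(\xi_1^\vee)^{\cong l(N)}$ the partial zeta function of $(L_1^\vee)^{\cong l(N)}$, normalized like $\xi_i^\vee$ (with $|P(x)/27|^{-s}$). The variable $s$ is fixed and suppressed. *)

theory Defs
  imports "HOL-Analysis.Analysis"
begin

text \<open>Binary cubic forms a u^3 + b u^2 v + c u v^2 + d v^3 as integer 4-tuples (a,b,c,d).\<close>
type_synonym form = "int \<times> int \<times> int \<times> int"

definition disc :: "form \<Rightarrow> int" where
  "disc x = (case x of (a,b,c,d) \<Rightarrow>
     b^2*c^2 + 18*a*b*c*d - 4*a*c^3 - 4*b^3*d - 27*a^2*d^2)"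

definition SL2Z :: "(int \<times> int \<times> int \<times> int) set" where
  "SL2Z = {(p,q,r,t). p*t - q*r = 1}"

text \<open>Linear change of variables: f(u,v) is replaced by f(p u + q v, r u + t v).\<close>
definition act :: "int \<times> int \<times> int \<times> int \<Rightarrow> form \<Rightarrow> form" where
  "act g x = (case g of (p,q,r,t) \<Rightarrow> case x of (a,b,c,d) \<Rightarrow>
     (a*p^3 + b*p^2*r + c*p*r^2 + d*r^3,
      3*a*p^2*q + b*(p^2*t + 2*p*q*r) + c*(q*r^2 + 2*p*r*t) + 3*d*r^2*t,
      3*a*p*q^2 + b*(q^2*r + 2*p*q*t) + c*(p*t^2 + 2*q*r*t) + 3*d*r*t^2,
      a*q^3 + b*q^2*t + c*q*t^2 + d*t^3))"

definition orbit_rel :: "form set \<Rightarrow> (form \<times> form) set" where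
  "orbit_rel X = {(x,y). x \<in> X \<and> y \<in> X \<and> (\<exists>g\<in>SL2Z. act g x = y)}"

text \<open>The set of SL2(Z)-orbits in X (X assumed SL2(Z)-stable).\<close>
definition orbits :: "form set \<Rightarrow> form set set" where
  "orbits X = X // orbit_rel X"

definition stab :: "form \<Rightarrow> (int \<times> int \<times> int \<times> int) set" where
  "stab x = {g \<in> SL2Z. act g x = x}"

text \<open>xi X j s = sum over orbits O with (-1)^(j-1) P(O) > 0 of |Stab|^-1 |P|^-s.
  Discriminant and stabilizer size are class invariants; a representative is chosen by SOME.\<close>
definition xi :: "form set \<Rightarrow> nat \<Rightarrow> complex \<Rightarrow> complex" where
  "xi X j s = infsum
     (\<lambda>C. (1 / of_nat (card (stab (SOME x. x \<in> C))))
           * (of_int \<bar>disc (SOME x. x \<in> C)\<bar> powr (-s)))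
     {C \<in> orbits X. (-1)^(j-1) * disc (SOME x. x \<in> C) > 0}"

text \<open>Dual normalisation: 3^{3s} xi, i.e. the sum with |P/27|^{-s}.\<close>
definition xi_dual :: "form set \<Rightarrow> nat \<Rightarrow> complex \<Rightarrow> complex" where
  "xi_dual X j s = (3::complex) powr (3 * s) * xi X j s"

definition L1 :: "form set" where "L1 = UNIV"
definition L2 :: "form set" where
  "L2 = {(a,b,c,d). even (a+b+d) \<and> even (a+c+d)}"
definition L3 :: "form set" where
  "L3 = {(a,b,c,d). even (a+b+c) \<and> even (b+c+d)}"
definition L4 :: "form set" where
  "L4 = {(a,b,c,d). even (b+c)}"
definition L5 :: "form set" where
  "L5 = {(a,b,c,d). even a \<and> even d \<and> even (b+c)}"

definition L1v :: "form set" where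
  "L1v = {(a,b,c,d). 3 dvd b \<and> 3 dvd c}"
definition L2v :: "form set" where "L2v = L1v \<inter> L3"
definition L3v :: "form set" where "L3v = L1v \<inter> L2"
definition L4v :: "form set" where "L4v = L1v \<inter> L5"
definition L5v :: "form set" where "L5v = L1v \<inter> L4"

definition L1_cong :: "int \<Rightarrow> int \<Rightarrow> form set" where
  "L1_cong l N = {x \<in> L1. disc x mod N = l mod N}"

definition L1v_cong :: "int \<Rightarrow> int \<Rightarrow> form set" where
  "L1v_cong l N = {x \<in> L1v. (disc x div 27) mod N = l mod N}"

end

theory Submission
  imports Defs
begin

text \<open>
  Write \<open>f \<mapsto> mass f\<close> for the orbit sum weighted by an \<open>SL\<^sub>2(\<int>)\<close>-invariant function \<open>f\<close>, so
  that \<open>\<xi>(X)\<close> is the mass of the indicator of \<open>X\<close>. The integral matrices \<open>h\<close> of determinant two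
  give a correspondence \<open>x \<circ> h = 2 y\<close>, equivalently \<open>y \<circ> adj h = 4 x\<close>, between forms \<open>x\<close> and forms
  \<open>y\<close> with \<open>P(y) = 4 P(x)\<close>. Counting it from both sides gives
  \<open>mass (T \<psi>) = 2\<^bsup>2s\<^esup> mass (\<psi> \<cdot> n)\<close>, where \<open>T \<psi> (x)\<close> is the sum of \<open>\<psi>\<close> over the \<open>y\<close>
  reached from \<open>x\<close> and \<open>n(y)\<close> is the number of \<open>x\<close> reached from \<open>y\<close>. All four identities follow by
  applying this to the indicators of \<open>P \<equiv> 4\<close> and \<open>P \<equiv> 20\<close> modulo 32, of the whole lattice, and of
  the forms with a triple root modulo 2; the remaining statements are congruences. Everything is
  compatible with a condition modulo 3, which gives the dual identities.

  Absolute convergence for \<open>Re s > 1\<close> comes from reduction theory: a cubic form is dominated by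
  a positive definite quadratic form of comparable discriminant (the Hessian if \<open>P > 0\<close>, and
  \<open>l\<^sup>2 + q\<close> for a real factorization \<open>l q\<close> if \<open>P < 0\<close>). A Minkowski reduced basis for it bounds the
  product of the coefficients by a multiple of \<open>|P|\<close>, unless the leading coefficient vanishes.
\<close>

section \<open>The action of integral matrices\<close>

type_synonym mat = "int \<times> int \<times> int \<times> int"

fun mm :: "mat \<Rightarrow> mat \<Rightarrow> mat" where
  "mm (p,q,r,t) (p',q',r',t') = (p*p' + q*r', p*q' + q*t', r*p' + t*r', r*q' + t*t')"

fun mdet :: "mat \<Rightarrow> int" where
  "mdet (p,q,r,t) = p*t - q*r"

fun madj :: "mat \<Rightarrow> mat" where
  "madj (p,q,r,t) = (t,-q,-r,p)"

fun smul :: "int \<Rightarrow> form \<Rightarrow> form" where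
  "smul k (a,b,c,d) = (k*a, k*b, k*c, k*d)"

abbreviation mone :: mat where "mone \<equiv> (1,0,0,1)"

lemma act_tuple:
  "act (p,q,r,t) (a,b,c,d) =
     (a*p^3 + b*p^2*r + c*p*r^2 + d*r^3,
      3*a*p^2*q + b*(p^2*t + 2*p*q*r) + c*(q*r^2 + 2*p*r*t) + 3*d*r^2*t,
      3*a*p*q^2 + b*(q^2*r + 2*p*q*t) + c*(p*t^2 + 2*q*r*t) + 3*d*r*t^2,
      a*q^3 + b*q^2*t + c*q*t^2 + d*t^3)"
  by (simp add: act_def)

lemma disc_tuple:
  "disc (a,b,c,d) = b^2*c^2 + 18*a*b*c*d - 4*a*c^3 - 4*b^3*d - 27*a^2*d^2"
  by (simp add: disc_def)

lemma SL2Z_iff_mdet: "g \<in> SL2Z \<longleftrightarrow> mdet g = 1"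
  by (cases g) (simp add: SL2Z_def)

lemma mdet_mm: "mdet (mm g h) = mdet g * mdet h"
  by (cases g; cases h) (simp add: algebra_simps)

lemma mdet_madj [simp]: "mdet (madj g) = mdet g"
  by (cases g) (simp add: algebra_simps)

lemma madj_madj [simp]: "madj (madj g) = g"
  by (cases g) simp

lemma mm_assoc: "mm (mm g h) k = mm g (mm h k)"
  by (cases g; cases h; cases k) (simp add: algebra_simps)

lemma mm_mone [simp]: "mm g mone = g" "mm mone g = g"
  by (cases g; simp)+

lemma mm_madj: "mdet g = 1 \<Longrightarrow> mm g (madj g) = mone" "mdet g = 1 \<Longrightarrow> mm (madj g) g = mone"
  by (cases g; simp add: algebra_simps)+

text \<open>Substitution is a right action: the factors act in the order in which they are
  written.\<close>

lemma act_mm: "act (mm h g) x = act g (act h x)"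
proof -
  obtain p q r t where g: "g = (p,q,r,t)" by (cases g)
  obtain p' q' r' t' where h: "h = (p',q',r',t')" by (cases h)
  obtain a b c d where x: "x = (a,b,c,d)" by (cases x)
  show ?thesis unfolding g h x mm.simps act_tuple prod.inject
    by (intro conjI; algebra)
qed

lemma act_mone [simp]: "act mone x = x"
  by (cases x) (simp add: act_tuple)

lemma act_smul: "act g (smul k x) = smul k (act g x)"
  by (cases g; cases x) (simp add: act_tuple algebra_simps)

text \<open>The product is a scalar matrix, and a cubic form picks up the cube of the scalar. At
  determinant two this is 8 = 2 * 4, which explains the factors 2 and 4 in the two directions of the
  correspondence.\<close>

lemma act_mm_madj: "act (mm g (madj g)) x = smul (mdet g ^ 3) x"
proof -
  obtain p q r t where g: "g = (p,q,r,t)" by (cases g)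
  obtain a b c d where x: "x = (a,b,c,d)" by (cases x)
  have "mm g (madj g) = (mdet g, 0, 0, mdet g)" by (simp add: g)
  thus ?thesis by (simp add: x act_tuple power2_eq_square power3_eq_cube)
qed

lemma act_inverse: "g \<in> SL2Z \<Longrightarrow> act g x = y \<longleftrightarrow> x = act (madj g) y"
  by (metis SL2Z_iff_mdet act_mm act_mone mm_madj)

lemma smul_smul: "smul k (smul l x) = smul (k * l) x"
  by (cases x) simp

lemma smul_inject: "k \<noteq> 0 \<Longrightarrow> smul k x = smul k y \<longleftrightarrow> x = y"
  by (cases x; cases y) simp

section \<open>The Hessian covariant and the discriminant\<close>

fun hess :: "form \<Rightarrow> int \<times> int \<times> int" where
  "hess (a,b,c,d) = (b^2 - 3*a*c, b*c - 9*a*d, c^2 - 3*b*d)"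

fun qdisc :: "int \<times> int \<times> int \<Rightarrow> int" where
  "qdisc (A,B,C) = B^2 - 4*A*C"

fun qact :: "mat \<Rightarrow> int \<times> int \<times> int \<Rightarrow> int \<times> int \<times> int" where
  "qact (p,q,r,t) (A,B,C) = (A*p^2 + B*p*r + C*r^2, 2*A*p*q + B*(p*t+q*r) + 2*C*r*t, A*q^2 + B*q*t + C*t^2)"

fun qsmul :: "int \<Rightarrow> int \<times> int \<times> int \<Rightarrow> int \<times> int \<times> int" where
  "qsmul k (A,B,C) = (k*A, k*B, k*C)"

lemma hess_act: "hess (act g x) = qsmul (mdet g ^ 2) (qact g (hess x))"
proof -
  obtain p q r t where g: "g = (p,q,r,t)" by (cases g)
  obtain a b c d where x: "x = (a,b,c,d)" by (cases x)
  show ?thesis unfolding g x act_tuple hess.simps qact.simps qsmul.simps mdet.simps prod.inject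
    by (intro conjI; algebra)
qed

lemma qdisc_qact: "qdisc (qact g A) = mdet g ^ 2 * qdisc A"
proof -
  obtain p q r t where g: "g = (p,q,r,t)" by (cases g)
  obtain a b c where x: "A = (a,b,c)" by (cases A)
  show ?thesis unfolding g x qact.simps qdisc.simps mdet.simps by algebra
qed

lemma qdisc_qsmul: "qdisc (qsmul k A) = k ^ 2 * qdisc A"
  by (cases A) (simp add: algebra_simps power2_eq_square)

lemma qdisc_hess: "qdisc (hess x) = - 3 * disc x"
proof -
  obtain a b c d where x: "x = (a,b,c,d)" by (cases x)
  show ?thesis unfolding x hess.simps qdisc.simps disc_tuple by algebra
qed

text \<open>Going through the Hessian avoids one identity of high degree: the scalar
  \<open>mdet g ^ 2\<close> of \<open>hess_act\<close> enters squared and \<open>qdisc_qact\<close>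
  adds another square, so the exponent is 4 + 2.\<close>

lemma disc_act: "disc (act g x) = mdet g ^ 6 * disc x"
proof -
  have "- 3 * disc (act g x) = - 3 * (mdet g ^ 6 * disc x)"
    unfolding qdisc_hess [symmetric] hess_act qdisc_qsmul qdisc_qact
    by (simp add: qdisc_hess power_mult [symmetric])
  thus ?thesis by simp
qed

lemma disc_smul: "disc (smul k x) = k ^ 4 * disc x"
proof -
  obtain a b c d where x: "x = (a,b,c,d)" by (cases x)
  show ?thesis unfolding x smul.simps disc_tuple by algebra
qed

lemma disc_act_SL2Z: "g \<in> SL2Z \<Longrightarrow> disc (act g x) = disc x"
  by (simp add: disc_act SL2Z_iff_mdet)

section \<open>Matrices of determinant two\<close>

text \<open>Representatives of the determinant two matrices modulo right multiplication by
  \<open>SL2Z\<close>. They belong to the three points (1,0), (0,1), (1,1) of the projective line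
  over F_2.\<close>

definition hecke_rep :: "nat \<Rightarrow> mat" where
  "hecke_rep i = (if i = 0 then (1,0,0,2) else if i = 1 then (2,0,0,1) else (1,0,1,2))"

lemma mdet_hecke_rep [simp]: "mdet (hecke_rep i) = 2"
  by (simp add: hecke_rep_def)

lemma hecke_rep_exhaust:
  assumes "mdet h = 2"
  obtains i g where "i < (3::nat)" "g \<in> SL2Z" "h = mm (hecke_rep i) g"
proof -
  obtain p q r t where h: "h = (p,q,r,t)" by (cases h)
  have d: "p*t - q*r = 2" using assms h by simp
  hence ev: "even (p*t - q*r)" by simp
  \<comment> \<open>The rows of \<open>h\<close> are dependent over F_2, so one row or the sum of
    both vanishes modulo 2. Halving it produces \<open>g\<close>.\<close>
  consider "even r" "even t" | "even p" "even q" | "even (r - p)" "even (t - q)"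
    using ev by auto
  thus ?thesis
  proof cases
    case 1
    then obtain r' t' where "r = 2*r'" "t = 2*t'" by (auto elim!: evenE)
    with d h show ?thesis
      by (intro that [of 0 "(p,q,r',t')"]) (auto simp: hecke_rep_def SL2Z_def)
  next
    case 2
    then obtain p' q' where "p = 2*p'" "q = 2*q'" by (auto elim!: evenE)
    with d h show ?thesis
      by (intro that [of 1 "(p',q',r,t)"]) (auto simp: hecke_rep_def SL2Z_def)
  next
    case 3
    then obtain r' t' where "r - p = 2*r'" "t - q = 2*t'" by (metis evenE)
    hence "r = p + 2*r'" "t = q + 2*t'" by auto
    with d h show ?thesis
      by (intro that [of 2 "(p,q,r',t')"]) (auto simp: hecke_rep_def SL2Z_def algebra_simps)
  qed
qed

lemma hecke_rep_unique:
  assumes "i < 3" "j < (3::nat)" "g \<in> SL2Z" "g' \<in> SL2Z"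
    and eq: "mm (hecke_rep i) g = mm (hecke_rep j) g'"
  shows "i = j \<and> g = g'"
proof -
  obtain p q r t where g: "g = (p,q,r,t)" by (cases g)
  obtain p' q' r' t' where g': "g' = (p',q',r',t')" by (cases g')
  have d: "p*t - q*r = 1" "p'*t' - q'*r' = 1"
    using assms g g' by (auto simp: SL2Z_def)
  have "odd (p*t - q*r)" "odd (p'*t' - q'*r')" unfolding d by simp_all
  \<comment> \<open>As the determinants are odd, neither a row nor the sum of the rows of
    \<open>g\<close> or \<open>g'\<close> vanishes modulo 2; two different indices would force
    this.\<close>
  hence o: "\<not> (even p \<and> even q)" "\<not> (even r \<and> even t)"
    "\<not> (even p' \<and> even q')" "\<not> (even r' \<and> even t')"
    "\<not> (even (p+r) \<and> even (q+t))" "\<not> (even (p'+r') \<and> even (q'+t'))"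
    by auto
  have "i = 0 \<or> i = 1 \<or> i = 2" "j = 0 \<or> j = 1 \<or> j = 2" using assms by linarith+
  thus ?thesis
  proof (elim disjE)
    assume "i = 0" "j = 2"
    with eq have "p' = 2*(r - r')" "q' = 2*(t - t')" by (auto simp: g g' hecke_rep_def)
    thus ?thesis using o(3) by simp
  next
    assume "i = 2" "j = 0"
    with eq have "p = 2*(r' - r)" "q = 2*(t' - t)" by (auto simp: g g' hecke_rep_def)
    thus ?thesis using o(1) by simp
  qed (use eq o in \<open>auto simp: g g' hecke_rep_def\<close>)
qed

section \<open>Counting the determinant two maps between two forms\<close>

definition isogenies :: "int \<Rightarrow> form \<Rightarrow> form \<Rightarrow> mat set" where
  "isogenies k x y = {h. mdet h = 2 \<and> act h x = smul k y}"

definition hecke_idx :: "int \<Rightarrow> form \<Rightarrow> form \<Rightarrow> nat set" where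
  "hecke_idx k x y = {i. i < 3 \<and> (\<exists>g\<in>SL2Z. act (mm (hecke_rep i) g) x = smul k y)}"

lemma finite_hecke_idx: "finite (hecke_idx k x y)"
  by (rule finite_subset [of _ "{..<3}"]) (auto simp: hecke_idx_def)

lemma SL2Z_mm: "g \<in> SL2Z \<Longrightarrow> h \<in> SL2Z \<Longrightarrow> mm g h \<in> SL2Z"
  by (simp add: SL2Z_iff_mdet mdet_mm)

lemma SL2Z_madj: "g \<in> SL2Z \<Longrightarrow> madj g \<in> SL2Z"
  by (simp add: SL2Z_iff_mdet)

lemma mone_SL2Z [simp]: "mone \<in> SL2Z"
  by (simp add: SL2Z_def)

text \<open>The isogenies in one coset of \<open>hecke_rep i\<close>, if there are any, form a
  single free orbit of \<open>stab y\<close> under right multiplication. \<open>hecke_idx\<close>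
  records the occupied cosets, and the choice \<open>c i\<close> fixes a base point in each.\<close>

lemma isogenies_bij:
  assumes k: "k \<noteq> 0"
  obtains f where "bij_betw f (hecke_idx k x y \<times> stab y) (isogenies k x y)"
proof -
  have "\<forall>i\<in>hecke_idx k x y. \<exists>g. g \<in> SL2Z \<and> act (mm (hecke_rep i) g) x = smul k y"
    by (auto simp: hecke_idx_def)
  then obtain c where c: "\<And>i. i \<in> hecke_idx k x y \<Longrightarrow> c i \<in> SL2Z"
      "\<And>i. i \<in> hecke_idx k x y \<Longrightarrow> act (mm (hecke_rep i) (c i)) x = smul k y"
    by metis
  define f where "f = (\<lambda>(i,s). mm (hecke_rep i) (mm (c i) s))"
  have "bij_betw f (hecke_idx k x y \<times> stab y) (isogenies k x y)"
    unfolding bij_betw_def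
  proof
    show "inj_on f (hecke_idx k x y \<times> stab y)"
    proof (rule inj_onI)
      fix u v assume u: "u \<in> hecke_idx k x y \<times> stab y" and v: "v \<in> hecke_idx k x y \<times> stab y"
        and e: "f u = f v"
      obtain i s where us: "u = (i,s)" by (cases u)
      obtain j s' where vs: "v = (j,s')" by (cases v)
      have m: "i \<in> hecke_idx k x y" "j \<in> hecke_idx k x y" "s \<in> SL2Z" "s' \<in> SL2Z"
        using u v by (auto simp: us vs stab_def)
      have ij: "i = j \<and> mm (c i) s = mm (c j) s'"
        by (rule hecke_rep_unique)
           (use m e c in \<open>auto simp: us vs f_def hecke_idx_def intro!: SL2Z_mm\<close>)
      hence "mm (madj (c i)) (mm (c i) s) = mm (madj (c i)) (mm (c i) s')" by metis
      hence "s = s'" using c(1) [OF m(1)] by (simp add: mm_assoc [symmetric] mm_madj SL2Z_iff_mdet)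
      thus "u = v" using ij us vs by simp
    qed
    show "f ` (hecke_idx k x y \<times> stab y) = isogenies k x y"
    proof
      show "f ` (hecke_idx k x y \<times> stab y) \<subseteq> isogenies k x y"
      proof
        fix h assume "h \<in> f ` (hecke_idx k x y \<times> stab y)"
        then obtain i s where i: "i \<in> hecke_idx k x y" and s: "s \<in> stab y"
          and h: "h = mm (mm (hecke_rep i) (c i)) s"
          by (auto simp: f_def mm_assoc)
        have "act h x = smul k y" unfolding h act_mm [of _ s] c(2) [OF i] act_smul
          using s by (simp add: stab_def)
        moreover have "mdet h = 2" using c(1) [OF i] s
          by (simp add: h mdet_mm SL2Z_iff_mdet stab_def)
        ultimately show "h \<in> isogenies k x y" by (simp add: isogenies_def)
      qed
      show "isogenies k x y \<subseteq> f ` (hecke_idx k x y \<times> stab y)"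
      proof
        fix h assume h: "h \<in> isogenies k x y"
        then obtain i g where ig: "i < 3" "g \<in> SL2Z" "h = mm (hecke_rep i) g"
          using hecke_rep_exhaust [of h] unfolding isogenies_def by blast
        have i: "i \<in> hecke_idx k x y"
          using h ig by (auto simp: isogenies_def hecke_idx_def)
        define s where "s = mm (madj (c i)) g"
        have ci: "mdet (c i) = 1" using c(1) [OF i] by (simp add: SL2Z_iff_mdet)
        have g: "g = mm (c i) s"
          unfolding s_def by (simp add: mm_assoc [symmetric] mm_madj ci)
        have s: "s \<in> SL2Z" using ig ci by (simp add: s_def SL2Z_iff_mdet mdet_mm)
        have "act s (smul k y) = smul k y"
          using h unfolding isogenies_def ig(3) g
          by (simp add: mm_assoc [symmetric] act_mm [of _ s] c(2) [OF i])
        hence "s \<in> stab y" using s k by (simp add: stab_def act_smul smul_inject)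
        thus "h \<in> f ` (hecke_idx k x y \<times> stab y)"
          using i ig g by (auto simp: f_def intro!: image_eqI [of _ _ "(i,s)"])
      qed
    qed
  qed
  thus ?thesis by (rule that)
qed

text \<open>Following a map by its adjugate multiplies the form by 8; cancelling k leaves the
  complementary factor \<open>8 div k\<close>.\<close>

lemma isogenies_madj: "bij_betw madj (isogenies 2 x y) (isogenies 4 y x)"
proof -
  have imp: "madj h \<in> isogenies (8 div k) y x" if "h \<in> isogenies k x y" "k \<in> {2,4}" for k h x y
  proof -
    have d: "mdet h = 2" and e: "act h x = smul k y" using that by (auto simp: isogenies_def)
    have "smul k (act (madj h) y) = act (madj h) (act h x)" by (simp add: e act_smul)
    also have "\<dots> = smul 8 x" by (simp add: act_mm [symmetric] act_mm_madj d)
    also have "\<dots> = smul k (smul (8 div k) x)" using that(2) by (auto simp: smul_smul)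
    finally have "act (madj h) y = smul (8 div k) x" using that(2) by (auto simp: smul_inject)
    thus ?thesis using d by (simp add: isogenies_def)
  qed
  show ?thesis
    by (rule bij_betw_byWitness [where f' = madj])
       (use imp [of _ 2 x y] imp [of _ 4 y x] in auto)
qed

text \<open>An infinite stabilizer has \<^term>\<open>card\<close> zero, hence weight zero; the identity survives
  because the stabilizers of isogenous forms are finite or infinite together.\<close>

lemma hecke_kernel:
  "complex_of_nat (card (hecke_idx 2 x y)) / of_nat (card (stab x)) =
   of_nat (card (hecke_idx 4 y x)) / of_nat (card (stab y))"
proof -
  obtain f where f: "bij_betw f (hecke_idx 2 x y \<times> stab y) (isogenies 2 x y)"
    using isogenies_bij [of 2 x y] by auto
  obtain g where g: "bij_betw g (hecke_idx 4 y x \<times> stab x) (isogenies 4 y x)"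
    using isogenies_bij [of 4 y x] by auto
  have fin: "finite (hecke_idx 2 x y \<times> stab y) \<longleftrightarrow> finite (hecke_idx 4 y x \<times> stab x)"
    using bij_betw_finite [OF f] bij_betw_finite [OF g] bij_betw_finite [OF isogenies_madj] by simp
  have emp: "hecke_idx 2 x y \<times> stab y = {} \<longleftrightarrow> hecke_idx 4 y x \<times> stab x = {}"
    using f g isogenies_madj [of x y] unfolding bij_betw_def by (metis image_is_empty)
  \<comment> \<open>Both products parametrize isogenies between the two forms, and taking adjugates
    identifies the two sets of isogenies.\<close>
  have "card (hecke_idx 2 x y \<times> stab y) = card (hecke_idx 4 y x \<times> stab x)"
    using bij_betw_same_card [OF f] bij_betw_same_card [OF g]
      bij_betw_same_card [OF isogenies_madj] by simp
  hence c: "card (hecke_idx 2 x y) * card (stab y) = card (hecke_idx 4 y x) * card (stab x)"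
    by (simp add: card_cartesian_product)
  have ne: "mone \<in> stab u" for u by (simp add: stab_def)
  hence ne': "stab u \<noteq> {}" for u by blast
  show ?thesis
  proof (cases "hecke_idx 2 x y = {}")
    case True
    with emp ne' have "hecke_idx 4 y x = {}" by auto
    with True show ?thesis by simp
  next
    case False
    with emp ne' have F: "hecke_idx 4 y x \<noteq> {}" by auto
    have fe: "finite (stab y) \<longleftrightarrow> finite (stab x)"
      using fin False F ne' finite_hecke_idx by (simp add: finite_cartesian_product_iff)
    show ?thesis
    proof (cases "finite (stab x)")
      case True
      hence "card (stab x) > 0" "card (stab y) > 0" using fe ne' by (auto simp: card_gt_0_iff)
      thus ?thesis using c by (simp add: field_simps) (metis of_nat_mult mult.commute)
    next
      case False
      thus ?thesis using fe by simp
    qed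
  qed
qed

section \<open>Reduction theory\<close>

definition ceval :: "real \<Rightarrow> real \<Rightarrow> real \<Rightarrow> real \<Rightarrow> real \<Rightarrow> real \<Rightarrow> real" where
  "ceval a b c d u v = a*u^3 + b*u^2* v + c*u* v^2 + d* v^3"

definition qeval :: "real \<Rightarrow> real \<Rightarrow> real \<Rightarrow> real \<Rightarrow> real \<Rightarrow> real" where
  "qeval A B C u v = A*u^2 + B*u* v + C* v^2"

definition rdisc :: "real \<Rightarrow> real \<Rightarrow> real \<Rightarrow> real \<Rightarrow> real" where
  "rdisc a b c d = b^2*c^2 + 18*a*b*c*d - 4*a*c^3 - 4*b^3*d - 27*a^2*d^2"

text \<open>The constant 125 = 5^3 is dictated by negative discriminant, where
  \<open>4*A*C - B^2\<close> comes out as 5 times the cube root of the absolute discriminant; for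
  positive discriminant the factor is 3.\<close>

definition majorant :: "real \<Rightarrow> real \<Rightarrow> real \<Rightarrow> real \<Rightarrow> real \<Rightarrow> real \<Rightarrow> real \<Rightarrow> bool" where
  "majorant a b c d A B C \<longleftrightarrow> A > 0 \<and> 4*A*C - B^2 > 0 \<and>
     (4*A*C - B^2)^3 \<le> 125 * \<bar>rdisc a b c d\<bar> \<and>
     (\<forall>u v. (ceval a b c d u v)^2 \<le> (qeval A B C u v)^3)"

text \<open>The classical syzygy of the covariants of a cubic: the squared term is the Jacobian
  determinant of the form and its Hessian.\<close>

lemma hessian_syzygy:
  fixes a b c d u v :: real
  defines "A \<equiv> b^2 - 3*a*c" and "B \<equiv> b*c - 9*a*d" and "C \<equiv> c^2 - 3*b*d"
  shows "4 * (qeval A B C u v)^3 =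
    ((3*a*u^2 + 2*b*u* v + c* v^2) * (B*u + 2*C* v) - (b*u^2 + 2*c*u* v + 3*d* v^2) * (2*A*u + B* v))^2
    + 27 * rdisc a b c d * (ceval a b c d u v)^2"
  unfolding assms qeval_def rdisc_def ceval_def by algebra

text \<open>The majorant is the Hessian divided by the cube root \<open>k\<close> of the
  discriminant; dropping the square in the syzygy gives the domination, with room to spare since 4 <
  27.\<close>

lemma majorant_pos_disc:
  assumes "rdisc a b c d > 0"
  shows "\<exists>A B C. majorant a b c d A B C"
proof -
  define A where "A = b^2 - 3*a*c"
  define B where "B = b*c - 9*a*d"
  define C where "C = c^2 - 3*b*d"
  define k where "k = root 3 (rdisc a b c d)"
  have k: "k > 0" "k^3 = rdisc a b c d" using assms by (simp_all add: k_def)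
  have D: "4*A*C - B^2 = 3 * k^3" unfolding k A_def B_def C_def rdisc_def by algebra
  have syz: "27 * k^3 * (ceval a b c d u v)^2 \<le> 4 * (qeval A B C u v)^3" for u v
    using hessian_syzygy [where a=a and b=b and c=c and d=d and u=u and v=v]
    by (simp add: A_def B_def C_def k)
  \<comment> \<open>The syzygy at (1,0) gives A >= 0, and the positive value of 4AC - B^2 then
    excludes A = 0.\<close>
  have "0 \<le> 27 * k^3 * (ceval a b c d 1 0)^2" using k(1) by simp
  also have "\<dots> \<le> 4 * A^3" using syz [of 1 0] by (simp add: qeval_def)
  finally have "A \<ge> 0" by (simp add: zero_le_power_eq)
  moreover have "A \<noteq> 0"
  proof
    assume "A = 0"
    hence "- (B^2) = 3 * k^3" using D by simp
    moreover have "3 * k^3 > 0" "B^2 \<ge> 0" using k(1) by auto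
    ultimately show False by linarith
  qed
  ultimately have A: "A > 0" by simp
  have D': "4*(A/k)*(C/k) - (B/k)^2 = 3 * k"
  proof -
    have "4*(A/k)*(C/k) - (B/k)^2 = (4*A*C - B^2) / k^2"
      using k(1) by (simp add: field_simps power2_eq_square)
    also have "\<dots> = 3 * k" unfolding D using k(1) by (simp add: power2_eq_square power3_eq_cube)
    finally show ?thesis .
  qed
  have dom: "(ceval a b c d u v)^2 \<le> (qeval (A/k) (B/k) (C/k) u v)^3" for u v
  proof -
    have q: "qeval (A/k) (B/k) (C/k) u v = qeval A B C u v / k"
      by (simp add: qeval_def add_divide_distrib)
    have z: "0 \<le> 27 * k^3 * (ceval a b c d u v)^2" using k(1) by simp
    hence "k^3 * (ceval a b c d u v)^2 \<le> (qeval A B C u v)^3"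
      using syz [of u v] by linarith
    thus ?thesis using k(1) by (simp add: q power_divide field_simps)
  qed
  have "majorant a b c d (A/k) (B/k) (C/k)"
    unfolding majorant_def D'
  proof (intro conjI allI dom)
    have "(3*k)^3 = 27 * rdisc a b c d" by (simp add: power_mult_distrib k(2))
    thus "(3*k)^3 \<le> 125 * \<bar>rdisc a b c d\<bar>" using assms by linarith
  qed (use A k(1) in auto)
  thus ?thesis by blast
qed

lemma cubic_has_root:
  fixes b c d :: real
  shows "\<exists>x. x^3 + b*x^2 + c*x + d = 0"
proof -
  \<comment> \<open>At both endpoints the lower terms are at most M^3 - M^2 in absolute value, so
    the cubic term decides the sign.\<close>
  define M where "M = 1 + \<bar>b\<bar> + \<bar>c\<bar> + \<bar>d\<bar>"
  have M: "M \<ge> 1" by (simp add: M_def)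
  have M2: "M^2 \<ge> M" "M^2 \<ge> 1" using M by (simp_all add: self_le_power)
  have bd: "\<bar>b*x^2 + c*x + d\<bar> \<le> M^3 - M^2" if "\<bar>x\<bar> = M" for x
  proof -
    have x2: "x^2 = M^2" using that by (metis power2_abs)
    have "\<bar>b*x^2 + c*x + d\<bar> \<le> \<bar>b*x^2\<bar> + \<bar>c*x\<bar> + \<bar>d\<bar>" by linarith
    also have "\<dots> = \<bar>b\<bar>*M^2 + \<bar>c\<bar>*M + \<bar>d\<bar>*1" using that by (simp add: abs_mult x2)
    also have "\<dots> \<le> \<bar>b\<bar>*M^2 + \<bar>c\<bar>*M^2 + \<bar>d\<bar>*M^2"
      using M2 by (intro add_mono mult_left_mono) auto
    also have "\<dots> = M^3 - M^2" by (simp add: M_def power3_eq_cube power2_eq_square algebra_simps)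
    finally show ?thesis .
  qed
  have "(-M)^3 + b*(-M)^2 + c*(-M) + d \<le> 0" using bd [of "-M"] M M2 by simp
  moreover have "M^3 + b*M^2 + c*M + d \<ge> 0" using bd [of M] M M2 by simp
  ultimately show ?thesis
    using IVT' [of "\<lambda>x. x^3 + b*x^2 + c*x + d" "-M" 0 M] M
    by (force intro!: continuous_intros)
qed

text \<open>For a = 0 the linear factor is v; otherwise a real root x of the dehomogenized cubic
  gives the factor u - x v.\<close>

lemma real_linear_factor:
  fixes a b c d :: real
  obtains l m A B C where "a = l*A" "b = l*B + m*A" "c = l*C + m*B" "d = m*C"
proof (cases "a = 0")
  case True
  thus ?thesis using that [of 0 b c 1 d] by simp
next
  case False
  obtain x where x: "x^3 + (b/a)*x^2 + (c/a)*x + d/a = 0" using cubic_has_root by blast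
  hence "a * (x^3 + (b/a)*x^2 + (c/a)*x + d/a) = 0" by simp
  hence "a*x^3 + b*x^2 + c*x + d = 0" using False by (simp add: algebra_simps)
  thus ?thesis
    by (intro that [of 1 a "b + a*x" "-x" "c + (b + a*x)*x"])
       (auto simp: algebra_simps power2_eq_square power3_eq_cube)
qed

lemma majorant_neg_disc:
  assumes "rdisc a b c d < 0"
  shows "\<exists>A B C. majorant a b c d A B C"
proof -
  obtain l0 m0 A0 B0 C0 where f0: "a = l0*A0" "b = l0*B0 + m0*A0" "c = l0*C0 + m0*B0" "d = m0*C0"
    by (rule real_linear_factor)
  have disc_factor: "rdisc a b c d = - ((4*A*C - B^2) * (A*m^2 - B*l*m + C*l^2)^2)"
    if "a = l*A" "b = l*B + m*A" "c = l*C + m*B" "d = m*C" for l m A B C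
    unfolding that rdisc_def by algebra
  have "(4*A0*C0 - B0^2) * (A0*m0^2 - B0*l0*m0 + C0*l0^2)^2 > 0"
    using disc_factor [OF f0] assms by linarith
  hence D0: "4*A0*C0 - B0^2 > 0" by (simp add: zero_less_mult_iff)
  hence "A0 \<noteq> 0" by auto
  then obtain l1 m1 A1 B1 C1 where f1: "a = l1*A1" "b = l1*B1 + m1*A1" "c = l1*C1 + m1*B1" "d = m1*C1"
    and A1: "A1 > 0" and D1: "4*A1*C1 - B1^2 > 0"
  proof (cases "A0 > 0")
    case True
    thus ?thesis using f0 D0 that by blast
  next
    case False
    thus ?thesis using f0 D0 \<open>A0 \<noteq> 0\<close> by (intro that [of "-l0" "-A0" "-B0" "-m0" "-C0"]) auto
  qed
  define D where "D = 4*A1*C1 - B1^2"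
  define R where "R = A1*m1^2 - B1*l1*m1 + C1*l1^2"
  have dR: "rdisc a b c d = - (D * R^2)" unfolding D_def R_def by (rule disc_factor [OF f1])
  have "4*A1*R = (2*A1*m1 - B1*l1)^2 + D*l1^2" unfolding R_def D_def by algebra
  moreover have "\<dots> \<ge> 0" using D1 by (simp add: D_def)
  ultimately have "A1 * R \<ge> 0" by simp
  hence "R \<ge> 0" using A1 by (simp add: zero_le_mult_iff)
  moreover have "R \<noteq> 0" using dR assms by auto
  ultimately have R: "R > 0" by simp
  \<comment> \<open>\<open>R\<close> is the value of the quadratic factor at the zero of the linear
    one. Scaling the linear factor by k and the quadratic one by 1/k turns \<open>R\<close> into k R
    and \<open>D\<close> into D/k^2. This k makes the two equal, to \<open>E\<close>, and the
    discriminant becomes -E^3.\<close>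
  define k where "k = root 3 (D/R)"
  have Dpos: "D > 0" using D1 by (simp add: D_def)
  have k: "k > 0" "k^3 = D/R" using Dpos R by (simp_all add: k_def)
  define l where "l = k*l1"  define m where "m = k*m1"
  define A where "A = A1/k"  define B where "B = B1/k"  define C where "C = C1/k"
  have f: "a = l*A" "b = l*B + m*A" "c = l*C + m*B" "d = m*C"
    using k(1) by (simp_all add: f1 l_def m_def A_def B_def C_def)
  define E where "E = 4*A*C - B^2"
  have E: "E = D / k^2" unfolding E_def D_def A_def B_def C_def
    using k(1) by (simp add: field_simps power2_eq_square)
  have Epos: "E > 0" using Dpos k(1) by (simp add: E)
  have "A*m^2 - B*l*m + C*l^2 = k*R" unfolding R_def A_def B_def C_def l_def m_def
    using k(1) by (simp add: field_simps power2_eq_square)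
  also have "\<dots> = E" using k R by (simp add: E field_simps power2_eq_square power3_eq_cube)
  finally have RE: "A*m^2 - B*l*m + C*l^2 = E" .
  have dE: "rdisc a b c d = - (E^3)"
    using disc_factor [OF f] unfolding RE E_def [symmetric] by (simp add: power2_eq_square power3_eq_cube)
  have Apos: "A > 0" using A1 k(1) by (simp add: A_def)
  have "4*(l^2 + A)*(m^2 + C) - (2*l*m + B)^2 = E + 4*(A*m^2 - B*l*m + C*l^2)"
    unfolding E_def by algebra
  hence D5: "4*(l^2 + A)*(m^2 + C) - (2*l*m + B)^2 = 5*E" unfolding RE by simp
  have dom: "(ceval a b c d u v)^2 \<le> (qeval (l^2 + A) (2*l*m + B) (m^2 + C) u v)^3" for u v
  proof -
    define X where "X = (l*u + m* v)^2"
    define Y where "Y = qeval A B C u v"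
    have "4*A*Y = (2*A*u + B* v)^2 + E* v^2" unfolding Y_def qeval_def E_def by algebra
    moreover have "\<dots> \<ge> 0" using Epos by simp
    ultimately have "A * Y \<ge> 0" by simp
    hence Y: "Y \<ge> 0" using Apos by (simp add: zero_le_mult_iff)
    have X: "X \<ge> 0" by (simp add: X_def)
    have "ceval a b c d u v = (l*u + m* v) * Y"
      unfolding f ceval_def Y_def qeval_def by algebra
    hence "(ceval a b c d u v)^2 = X * Y^2" by (simp add: X_def power_mult_distrib)
    also have "\<dots> \<le> (X + Y) * (X + Y)^2"
      using X Y by (intro mult_mono power_mono) auto
    also have "\<dots> = (X + Y)^3" by (simp add: power2_eq_square power3_eq_cube)
    also have "X + Y = qeval (l^2 + A) (2*l*m + B) (m^2 + C) u v"
      unfolding X_def Y_def qeval_def by algebra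
    finally show ?thesis .
  qed
  have "majorant a b c d (l^2 + A) (2*l*m + B) (m^2 + C)"
    unfolding majorant_def D5
    using Apos Epos dom by (auto simp: dE power_mult_distrib add_nonneg_pos)
  thus ?thesis by blast
qed

lemma majorant_exists: "rdisc a b c d \<noteq> 0 \<Longrightarrow> \<exists>A B C. majorant a b c d A B C"
  using majorant_pos_disc majorant_neg_disc by (meson linorder_neqE)

section \<open>Minkowski reduction of binary quadratic forms\<close>

lemma qeval_bounds:
  assumes "A > 0" "4*A*C - B^2 > 0"
  shows "(4*A*C - B^2) * v^2 \<le> 4*A*qeval A B C u v"
    "(4*A*C - B^2) * u^2 \<le> 4*C*qeval A B C u v"
    "(u,v) \<noteq> (0,0) \<Longrightarrow> qeval A B C u v > 0" and "C > 0"
proof -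
  have "4*A*qeval A B C u v = (2*A*u + B* v)^2 + (4*A*C - B^2) * v^2"
    unfolding qeval_def by algebra
  thus 1: "(4*A*C - B^2) * v^2 \<le> 4*A*qeval A B C u v" by simp
  have "4*C*qeval A B C u v = (2*C* v + B*u)^2 + (4*A*C - B^2) * u^2"
    unfolding qeval_def by algebra
  thus "(4*A*C - B^2) * u^2 \<le> 4*C*qeval A B C u v" by simp
  have "B^2 \<ge> 0" by simp
  hence "A * C > 0" using assms(2) by linarith
  thus "C > 0" using assms(1) by (simp add: zero_less_mult_iff)
  assume n: "(u,v) \<noteq> (0,0)"
  show "qeval A B C u v > 0"
  proof (cases "v = 0")
    case True
    thus ?thesis using n assms by (simp add: qeval_def)
  next
    case False
    hence "(4*A*C - B^2) * v^2 > 0" using assms by simp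
    hence "4*A*qeval A B C u v > 0" using 1 by linarith
    thus ?thesis using assms(1) by (simp add: zero_less_mult_iff)
  qed
qed

lemma int_abs_le_square: "\<bar>n\<bar> \<le> n^2" for n :: int
  using self_le_power [of "\<bar>n\<bar>" 2] by (cases "n = 0") auto

lemma minimal_vector_exists:
  fixes A B C :: real
  assumes "A > 0" "4*A*C - B^2 > 0"
  obtains p r :: int where "(p,r) \<noteq> (0::int,0::int)"
    "\<And>(u::int) (v::int). (u,v) \<noteq> (0::int,0::int) \<Longrightarrow> qeval A B C p r \<le> qeval A B C u v"
proof -
  define D where "D = 4*A*C - B^2"
  define Q where "Q = (\<lambda>(u::int,v::int). qeval A B C u v)"
  \<comment> \<open>The vector (1,0) has value \<open>A\<close>, so a minimum over vectors of value
    at most \<open>A\<close> is a global one; the bounds by completing the square make this set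
    finite.\<close>
  define S where "S = {w. w \<noteq> (0,0) \<and> Q w \<le> A}"
  have D: "D > 0" using assms by (simp add: D_def)
  have C: "C > 0" using qeval_bounds(4) [OF assms] .
  have bnd: "\<bar>n\<bar> \<le> \<lceil>4*K*A/D\<rceil>" if "D * (real_of_int n)^2 \<le> 4*K*q" "q \<le> A" "K > 0" for K q and n :: int
  proof -
    have "D * (real_of_int n)^2 \<le> 4*K*A"
      using that by (smt (verit) mult_left_mono)
    hence "(real_of_int n)^2 \<le> 4*K*A/D" using D by (simp add: field_simps)
    hence "real_of_int (n^2) \<le> 4*K*A/D" by simp
    hence "n^2 \<le> \<lceil>4*K*A/D\<rceil>" by linarith
    thus ?thesis using int_abs_le_square [of n] by linarith
  qed
  have "S \<subseteq> {- \<lceil>4*C*A/D\<rceil>..\<lceil>4*C*A/D\<rceil>} \<times> {- \<lceil>4*A*A/D\<rceil>..\<lceil>4*A*A/D\<rceil>}"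
  proof
    fix w assume w: "w \<in> S"
    obtain u v where uv: "w = (u,v)" by (cases w)
    have q: "qeval A B C u v \<le> A" using w by (simp add: S_def Q_def uv)
    have "\<bar>u\<bar> \<le> \<lceil>4*C*A/D\<rceil>" "\<bar>v\<bar> \<le> \<lceil>4*A*A/D\<rceil>"
      using bnd [OF _ q C] bnd [OF _ q assms(1)] qeval_bounds(1,2) [OF assms, folded D_def] by blast+
    thus "w \<in> {- \<lceil>4*C*A/D\<rceil>..\<lceil>4*C*A/D\<rceil>} \<times> {- \<lceil>4*A*A/D\<rceil>..\<lceil>4*A*A/D\<rceil>}"
      unfolding uv by auto
  qed
  hence fin: "finite S" by (rule finite_subset) auto
  have one: "(1,0) \<in> S" by (simp add: S_def Q_def qeval_def)
  have "Min (Q ` S) \<in> Q ` S" using fin one by (intro Min_in) auto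
  then obtain w where w: "w \<in> S" "Q w = Min (Q ` S)" by auto
  obtain p r where pr: "w = (p,r)" by (cases w)
  have mn: "qeval A B C p r \<le> qeval A B C u v" if uv: "(u,v) \<noteq> (0,0)" for u v :: int
  proof (cases "(u,v) \<in> S")
    case True
    hence "Q w \<le> Q (u,v)" using w fin by auto
    thus ?thesis by (simp add: pr Q_def)
  next
    case False
    hence "Q (u,v) > A" using uv by (auto simp: S_def)
    moreover have "Q w \<le> A" using w by (simp add: S_def)
    ultimately show ?thesis by (simp add: pr Q_def)
  qed
  have "(p,r) \<noteq> (0,0)" using w pr by (simp add: S_def)
  thus ?thesis using mn by (rule that)
qed

text \<open>A minimal vector is primitive, since dividing it by g divides its value by g^2. Bezout
  completes it to a basis. Adding multiples of it to the second vector shifts the middle coefficient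
  by multiples of 2 M, so rounding brings that coefficient between -M and M.\<close>

lemma reduced_basis_exists:
  fixes A B C :: real
  assumes pd: "A > 0" "4*A*C - B^2 > 0"
  obtains p q r t :: int where "p*t - q*r = 1"
    "\<bar>2*A*p*q + B*(p*t + q*r) + 2*C*r*t\<bar> \<le> qeval A B C p r"
    "qeval A B C p r \<le> qeval A B C q t"
proof -
  obtain p r :: int where pr: "(p,r) \<noteq> (0,0)"
    and mn: "\<And>(u::int) (v::int). (u,v) \<noteq> (0::int,0::int) \<Longrightarrow> qeval A B C p r \<le> qeval A B C u v"
    by (rule minimal_vector_exists [OF pd]) blast
  define M where "M = qeval A B C p r"
  have M: "M > 0" unfolding M_def using pr by (intro qeval_bounds(3) [OF pd]) auto
  define g where "g = gcd p r"
  have g: "g > 0" using pr by (auto simp: g_def)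
  obtain p' r' where p': "p = g * p'" and r': "r = g * r'"
    unfolding g_def by (metis dvd_def gcd_dvd1 gcd_dvd2)
  have "M = g^2 * qeval A B C p' r'"
    unfolding M_def p' r' qeval_def by (simp add: power_mult_distrib algebra_simps power2_eq_square)
  moreover have "qeval A B C p' r' \<ge> M" unfolding M_def using pr p' r' by (intro mn) auto
  ultimately have "real_of_int (g^2) * M \<le> 1 * M"
    by (smt (verit) mult_left_mono of_int_power zero_le_power2)
  hence "real_of_int (g^2) \<le> 1" using M by (metis mult_le_cancel_right_pos)
  hence "g^2 \<le> 1" by linarith
  hence g1: "gcd p r = 1" using g int_abs_le_square [of g] unfolding g_def by linarith
  obtain t0 q0' where "t0 * p + q0' * r = gcd p r" using bezout_int by blast
  define q0 where "q0 = - q0'"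
  have d0: "p*t0 - q0*r = 1"
    using \<open>t0 * p + q0' * r = gcd p r\<close> g1 by (simp add: q0_def algebra_simps)
  define b0 where "b0 = 2*A*p*q0 + B*(p*t0 + q0*r) + 2*C*r*t0"
  define n where "n = round (- b0 / (2*M))"
  define q where "q = q0 + n*p"
  define t where "t = t0 + n*r"
  have d: "p*t - q*r = 1" using d0 unfolding q_def t_def by algebra
  have "2*A*p*q + B*(p*t + q*r) + 2*C*r*t = b0 + 2*n*M"
    unfolding q_def t_def b0_def M_def qeval_def by simp algebra
  moreover have "\<bar>b0 + 2*n*M\<bar> \<le> M"
  proof -
    have "\<bar>real_of_int n - (- b0 / (2*M))\<bar> \<le> 1/2" unfolding n_def by (rule of_int_round_abs_le)
    hence "\<bar>real_of_int n - (- b0 / (2*M))\<bar> * (2*M) \<le> 1/2 * (2*M)"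
      using M by (intro mult_right_mono) auto
    hence "\<bar>(real_of_int n - (- b0 / (2*M))) * (2*M)\<bar> \<le> M" using M by (simp add: abs_mult)
    moreover have "(real_of_int n - (- b0 / (2*M))) * (2*M) = b0 + 2*n*M"
      using M by (simp add: algebra_simps)
    ultimately show ?thesis by simp
  qed
  moreover have "M \<le> qeval A B C q t" unfolding M_def using d by (intro mn) auto
  ultimately show ?thesis using d by (intro that [of p t q r]) (simp_all add: M_def)
qed

text \<open>Evaluation at (1,0) and (0,1) bounds a and d. For b and c the form is evaluated at (w,
  s) and (w, -s) with w = sqrt C and s = sqrt A, where the quadratic form is at most 3 (s w)^2; sum
  and difference of the two values separate the terms.\<close>

lemma majorant_coefficient_bounds:
  assumes maj: "majorant a b c d A B C" and red: "\<bar>B\<bar> \<le> A" "A \<le> C"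
  shows "\<bar>a\<bar> \<le> (sqrt A)^3" "\<bar>b\<bar> \<le> 7 * (sqrt A)^2 * sqrt C"
    "\<bar>c\<bar> \<le> 7 * sqrt A * (sqrt C)^2" "\<bar>d\<bar> \<le> (sqrt C)^3"
proof -
  define s where "s = sqrt A"
  define w where "w = sqrt C"
  have A: "A > 0" using maj by (simp add: majorant_def)
  have sw: "s > 0" "s^2 = A" "w > 0" "w^2 = C" "s \<le> w" using A red by (auto simp: s_def w_def)
  have dom: "(ceval a b c d u v)^2 \<le> (qeval A B C u v)^3" for u v
    using maj by (simp add: majorant_def)
  have root6: "\<bar>x\<bar> \<le> y^3" if "x^2 \<le> (y^2)^3" "y \<ge> 0" for x y :: real
  proof -
    have "\<bar>x\<bar>^2 \<le> (y^3)^2" using that by (simp add: power_mult [symmetric])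
    thus ?thesis using that(2) by (meson power2_le_imp_le zero_le_power)
  qed
  show a: "\<bar>a\<bar> \<le> (sqrt A)^3" using dom [of 1 0] sw
    by (intro root6) (auto simp: ceval_def qeval_def)
  show d: "\<bar>d\<bar> \<le> (sqrt C)^3" using dom [of 0 1] sw A red
    by (intro root6) (auto simp: ceval_def qeval_def)
  define m where "m = (s*w)^3"
  have m: "m > 0" using sw by (simp add: m_def)
  \<comment> \<open>The factor 6 comes from 3^3 = 27 <= 6^2.\<close>
  have six: "\<bar>ceval a b c d w v\<bar> \<le> 6 * m" if "v = s \<or> v = - s" for v
  proof -
    have "\<bar>B * w * v\<bar> \<le> A * w * w"
      using that red sw A by (auto simp: abs_mult intro!: mult_mono)
    moreover have "A * w * w = (s*w)^2"
      unfolding sw(2) [symmetric] by (simp add: power2_eq_square)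
    ultimately have "B * w * v \<le> (s*w)^2" by linarith
    moreover have "A*w^2 = (s*w)^2" "C* v^2 = (s*w)^2"
      using sw that by (auto simp: power_mult_distrib)
    ultimately have q: "qeval A B C w v \<le> 3 * (s*w)^2" unfolding qeval_def by linarith
    have "qeval A B C w v \<ge> 0"
      using qeval_bounds(3) [of A C B w v] maj sw(3) by (fastforce simp: majorant_def)
    hence "(qeval A B C w v)^3 \<le> (3 * (s*w)^2)^3" using q by (intro power_mono)
    also have "\<dots> \<le> (6 * m)^2"
      by (simp add: m_def power_mult_distrib power_mult [symmetric])
    finally have "(ceval a b c d w v)^2 \<le> (6*m)^2" using dom [of w v] by linarith
    thus ?thesis using m by (metis abs_le_square_iff abs_of_pos mult_pos_pos zero_less_numeral)
  qed
  define X where "X = a*w^3"  define Y where "Y = b*w^2* s"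
  define Z where "Z = c*w* s^2"  define W where "W = d* s^3"
  have "ceval a b c d w s = X + Y + Z + W" "ceval a b c d w (-s) = X - Y + Z - W"
    by (simp_all add: ceval_def X_def Y_def Z_def W_def)
  hence 1: "\<bar>X + Y + Z + W\<bar> \<le> 6*m" "\<bar>X - Y + Z - W\<bar> \<le> 6*m"
    using six [of s] six [of "-s"] by auto
  have "\<bar>X\<bar> \<le> m" using a sw mult_right_mono [OF a, of "w^3"]
    by (simp add: X_def m_def s_def w_def power_mult_distrib abs_mult)
  moreover have "\<bar>W\<bar> \<le> m" using d sw mult_right_mono [OF d, of "s^3"]
    by (simp add: W_def m_def s_def w_def power_mult_distrib abs_mult mult.commute)
  ultimately have YZ: "\<bar>Y\<bar> \<le> 7*m" "\<bar>Z\<bar> \<le> 7*m" using 1 by linarith+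
  have "\<bar>b\<bar> * (w^2* s) \<le> (7* s^2*w) * (w^2* s)"
    using YZ(1) sw(1,3) by (simp add: Y_def m_def abs_mult power2_eq_square power3_eq_cube mult_ac)
  thus "\<bar>b\<bar> \<le> 7 * (sqrt A)^2 * sqrt C" using sw by (simp add: s_def w_def)
  have "\<bar>c\<bar> * (w* s^2) \<le> (7* s*w^2) * (w* s^2)"
    using YZ(2) sw(1,3) by (simp add: Z_def m_def abs_mult power2_eq_square power3_eq_cube mult_ac)
  thus "\<bar>c\<bar> \<le> 7 * sqrt A * (sqrt C)^2" using sw by (simp add: s_def w_def)
qed

text \<open>The product estimate is derived from |a| >= 1, so forms with a = 0 get the second
  alternative. The constant 1200 is a round number above 125 * 256 / 27.\<close>

definition reduced_forms :: "form set" where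
  "reduced_forms = {(a,b,c,d). disc (a,b,c,d) \<noteq> 0 \<and>
     ((1 + \<bar>a\<bar>) * (1 + \<bar>b\<bar>) * (1 + \<bar>c\<bar>) * (1 + \<bar>d\<bar>) \<le> 1200 * \<bar>disc (a,b,c,d)\<bar>
      \<or> a = 0 \<and> b \<noteq> 0 \<and> \<bar>c\<bar> \<le> \<bar>b\<bar>)}"

lemma rdisc_of_int: "rdisc (of_int a) (of_int b) (of_int c) (of_int d) = of_int (disc (a,b,c,d))"
  by (simp add: rdisc_def disc_tuple)

text \<open>For a = 0 the substitution u -> u + n v changes c by 2 b n, hence the modulus 2
  b.\<close>

lemma centered_residue:
  fixes b c :: int
  assumes "b \<noteq> 0"
  shows "\<exists>n. \<bar>c + 2*b*n\<bar> \<le> \<bar>b\<bar>"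
proof -
  define m where "m = \<bar>b\<bar>"
  have m: "m > 0" using assms by (simp add: m_def)
  define k where "k = (c + m) div (2*m)"
  have "c + m = 2*m*k + (c + m) mod (2*m)" unfolding k_def by (simp add: mult_div_mod_eq)
  moreover have "0 \<le> (c + m) mod (2*m)" "(c + m) mod (2*m) < 2*m" using m by simp_all
  ultimately have "\<bar>c - 2*m*k\<bar> \<le> m" by linarith
  thus ?thesis unfolding m_def
    by (cases "b > 0") (auto intro: exI [of _ "-k"] exI [of _ k] simp: m_def)
qed

lemma reduce_zero_leading:
  assumes "disc (0,b,c,d) \<noteq> 0"
  shows "\<exists>g\<in>SL2Z. act g (0,b,c,d) \<in> reduced_forms"
proof -
  have b: "b \<noteq> 0" using assms by (auto simp: disc_tuple)
  obtain n where n: "\<bar>c + 2*b*n\<bar> \<le> \<bar>b\<bar>" using centered_residue [OF b] by blast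
  have g: "(1,n,0,1) \<in> SL2Z" by (simp add: SL2Z_def)
  have e: "act (1,n,0,1) (0,b,c,d) = (0, b, c + 2*b*n, b*n^2 + c*n + d)"
    by (simp add: act_tuple algebra_simps)
  have "disc (act (1,n,0,1) (0,b,c,d)) \<noteq> 0" using disc_act_SL2Z [OF g] assms by simp
  hence "act (1,n,0,1) (0,b,c,d) \<in> reduced_forms"
    unfolding e using n b by (simp add: reduced_forms_def)
  thus ?thesis using g by blast
qed

text \<open>From |a| >= 1 follow s >= 1 and w >= 1, so each factor 1 + |coefficient| is at most a
  constant times its monomial in s and w. The monomials multiply to (s w)^6 = (A C)^3, and
  reducedness gives 3 A C <= 4 A C - B^2.\<close>

lemma reduce_nonzero_leading:
  fixes a b c d :: int
  assumes maj: "majorant a b c d A B C" and red: "\<bar>B\<bar> \<le> A" "A \<le> C" and a: "a \<noteq> 0"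
  shows "(1 + \<bar>a\<bar>) * (1 + \<bar>b\<bar>) * (1 + \<bar>c\<bar>) * (1 + \<bar>d\<bar>) \<le> 1200 * \<bar>disc (a,b,c,d)\<bar>"
proof -
  define s where "s = sqrt A"
  define w where "w = sqrt C"
  have A: "A > 0" "4*A*C - B^2 > 0" using maj by (auto simp: majorant_def)
  have sw: "s > 0" "s^2 = A" "w > 0" "w^2 = C" "s \<le> w" using A red by (auto simp: s_def w_def)
  have bd: "\<bar>real_of_int a\<bar> \<le> s^3" "\<bar>real_of_int b\<bar> \<le> 7 * (s^2 * w)"
    "\<bar>real_of_int c\<bar> \<le> 7 * (s * w^2)" "\<bar>real_of_int d\<bar> \<le> w^3"
    using majorant_coefficient_bounds [OF maj red] by (simp_all add: s_def w_def mult.assoc)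
  have "1 \<le> \<bar>real_of_int a\<bar>" using a by linarith
  hence "1 \<le> s^3" using bd by linarith
  hence s1: "1 \<le> s" using sw(1) by (metis linorder_not_le power_less_one_iff less_le_not_le zero_less_numeral)
  hence w1: "1 \<le> w" using sw by linarith
  have ge1: "1 \<le> s^2 * w" "1 \<le> s * w^2" "1 \<le> w^3"
    using s1 w1 by (auto intro!: mult_ge1_I one_le_power)
  have "(1 + \<bar>real_of_int a\<bar>) * (1 + \<bar>real_of_int b\<bar>) * (1 + \<bar>real_of_int c\<bar>) * (1 + \<bar>real_of_int d\<bar>)
      \<le> (2 * s^3) * (8 * (s^2 * w)) * (8 * (s * w^2)) * (2 * w^3)"
  proof (intro mult_mono)
    show "1 + \<bar>real_of_int a\<bar> \<le> 2 * s^3" "1 + \<bar>real_of_int b\<bar> \<le> 8 * (s^2 * w)"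
      "1 + \<bar>real_of_int c\<bar> \<le> 8 * (s * w^2)" "1 + \<bar>real_of_int d\<bar> \<le> 2 * w^3"
      using bd ge1 \<open>1 \<le> s^3\<close> by linarith+
  qed (use sw(1,3) in auto)
  also have "\<dots> = 256 * (s^2)^3 * (w^2)^3" by (simp add: power_mult [symmetric]) algebra
  also have "\<dots> = 256 * (A * C)^3" by (simp add: sw power_mult_distrib)
  also have "\<dots> \<le> 256 * ((4*A*C - B^2) / 3)^3"
  proof -
    have "B^2 \<le> A^2" using red(1) A(1) by (simp add: abs_le_square_iff [symmetric])
    also have "\<dots> = A * A" by (rule power2_eq_square)
    also have "\<dots> \<le> A * C" using A red by (intro mult_left_mono) auto
    finally have "A * C \<le> (4*A*C - B^2) / 3" by simp
    moreover have "0 \<le> A * C" using A red by simp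
    ultimately show ?thesis by (intro mult_left_mono power_mono) auto
  qed
  also have "\<dots> = 256/27 * (4*A*C - B^2)^3" by (simp add: power_divide)
  also have "\<dots> \<le> 256/27 * (125 * \<bar>rdisc a b c d\<bar>)"
    using maj by (intro mult_left_mono) (auto simp: majorant_def)
  also have "\<dots> \<le> 1200 * \<bar>rdisc a b c d\<bar>" by simp
  finally have "real_of_int ((1 + \<bar>a\<bar>) * (1 + \<bar>b\<bar>) * (1 + \<bar>c\<bar>) * (1 + \<bar>d\<bar>)) \<le> real_of_int (1200 * \<bar>disc (a,b,c,d)\<bar>)"
    by (simp add: rdisc_of_int)
  thus ?thesis by linarith
qed

text \<open>Being a majorant is preserved when both forms undergo the same unimodular substitution,
  so the matrix that reduces the majorant can be applied to the cubic form.\<close>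

lemma reduced_representative:
  assumes "disc x \<noteq> 0"
  shows "\<exists>g\<in>SL2Z. act g x \<in> reduced_forms"
proof -
  obtain a b c d where x: "x = (a,b,c,d)" by (cases x)
  have "rdisc a b c d \<noteq> 0" using assms by (simp add: x rdisc_of_int)
  then obtain A B C where maj: "majorant a b c d A B C" using majorant_exists by blast
  hence pd: "A > 0" "4*A*C - B^2 > 0" by (auto simp: majorant_def)
  obtain p q r t :: int where pt: "p*t - q*r = 1"
    and red: "\<bar>2*A*p*q + B*(p*t + q*r) + 2*C*r*t\<bar> \<le> qeval A B C p r"
      "qeval A B C p r \<le> qeval A B C q t"
    by (rule reduced_basis_exists [OF pd])
  define A' where "A' = qeval A B C p r"
  define B' where "B' = 2*A*p*q + B*(p*t + q*r) + 2*C*r*t"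
  define C' where "C' = qeval A B C q t"
  have g: "(p,q,r,t) \<in> SL2Z" using pt by (simp add: SL2Z_def)
  obtain a' b' c' d' where y: "act (p,q,r,t) x = (a',b',c',d')" by (cases "act (p,q,r,t) x")
  have dy: "disc (a',b',c',d') = disc x" using disc_act_SL2Z [OF g, of x] by (simp add: y)
  have co: "a' = a*p^3 + b*p^2*r + c*p*r^2 + d*r^3"
      "b' = 3*a*p^2*q + b*(p^2*t + 2*p*q*r) + c*(q*r^2 + 2*p*r*t) + 3*d*r^2*t"
      "c' = 3*a*p*q^2 + b*(q^2*r + 2*p*q*t) + c*(p*t^2 + 2*q*r*t) + 3*d*r*t^2"
      "d' = a*q^3 + b*q^2*t + c*q*t^2 + d*t^3"
    using y unfolding x act_tuple by auto
  have ce: "ceval a' b' c' d' u v = ceval a b c d (p*u + q* v) (r*u + t* v)" for u v :: real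
    unfolding ceval_def co by simp algebra
  have qe: "qeval A' B' C' u v = qeval A B C (p*u + q* v) (r*u + t* v)" for u v :: real
    unfolding qeval_def A'_def B'_def C'_def by simp algebra
  have "4*A'*C' - B'^2 = (p*t - q*r)^2 * (4*A*C - B^2)"
    unfolding qeval_def A'_def B'_def C'_def by simp algebra
  hence D: "4*A'*C' - B'^2 = 4*A*C - B^2" using pt by simp
  have "(p,r) \<noteq> (0,0)" using pt by auto
  hence "A' > 0" unfolding A'_def by (intro qeval_bounds(3) [OF pd]) auto
  hence maj': "majorant a' b' c' d' A' B' C'"
    using maj unfolding majorant_def D ce qe rdisc_of_int dy x by auto
  show ?thesis
  proof (cases "a' = 0")
    case True
    then obtain h where h: "h \<in> SL2Z" "act h (a',b',c',d') \<in> reduced_forms"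
      using reduce_zero_leading dy assms by metis
    thus ?thesis using g y SL2Z_mm act_mm by metis
  next
    case False
    have "(a',b',c',d') \<in> reduced_forms"
      using reduce_nonzero_leading [OF maj' _ _ False] red dy assms
      by (auto simp: reduced_forms_def A'_def B'_def C'_def)
    thus ?thesis using g y by metis
  qed
qed

section \<open>Convergence of the orbit sum\<close>

lemma summable_on_int_powr:
  assumes "\<sigma> > (1::real)"
  shows "(\<lambda>n::int. (1 + \<bar>real_of_int n\<bar>) powr (-\<sigma>)) summable_on UNIV"
proof -
  have "summable (\<lambda>n. real n powr (-\<sigma>))" using assms by (simp add: summable_real_powr_iff)
  hence "summable (\<lambda>n. real (n + 1) powr (-\<sigma>))" by (rule summable_ignore_initial_segment)
  hence s1: "summable (\<lambda>n. (1 + real n) powr (-\<sigma>))" by (simp add: add.commute)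
  hence "summable (\<lambda>n. (1 + real (n + 1)) powr (-\<sigma>))" by (rule summable_ignore_initial_segment)
  hence s2: "(\<lambda>n::nat. (1 + \<bar>real_of_int (- int n - 1)\<bar>) powr (-\<sigma>)) summable_on UNIV"
    by (subst summable_on_UNIV_nonneg_real_iff) (simp_all add: add.commute)
  have s1: "(\<lambda>n::nat. (1 + \<bar>real_of_int (int n)\<bar>) powr (-\<sigma>)) summable_on UNIV"
    using s1 by (subst summable_on_UNIV_nonneg_real_iff) simp_all
  have 1: "(\<lambda>n::int. (1 + \<bar>real_of_int n\<bar>) powr (-\<sigma>)) summable_on range int"
    using s1 by (subst summable_on_reindex) (auto simp: o_def)
  have 2: "(\<lambda>n::int. (1 + \<bar>real_of_int n\<bar>) powr (-\<sigma>)) summable_on range (\<lambda>n. - int n - 1)"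
    using s2 by (subst summable_on_reindex) (auto simp: o_def inj_def)
  have "n \<in> range int \<union> range (\<lambda>n. - int n - 1)" for n :: int
  proof (cases "n \<ge> 0")
    case True
    thus ?thesis by (auto intro: image_eqI [of _ _ "nat n"])
  next
    case False
    thus ?thesis by (auto intro: image_eqI [of _ _ "nat (- n - 1)"])
  qed
  hence "range int \<union> range (\<lambda>n. - int n - 1) = UNIV" by auto
  moreover have "range int \<inter> range (\<lambda>n. - int n - 1) = {}" by auto
  ultimately show ?thesis using summable_on_Un_disjoint [OF 1 2] by simp
qed

lemma summable_on_product_nonneg:
  fixes f :: "'a \<Rightarrow> real" and g :: "'b \<Rightarrow> real"
  assumes "f summable_on A" "g summable_on B" "\<And>x. f x \<ge> 0" "\<And>y. g y \<ge> 0"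
  shows "(\<lambda>(x,y). f x * g y) summable_on A \<times> B"
proof (rule summable_on_SigmaI)
  show "((\<lambda>y. case (x,y) of (x,y) \<Rightarrow> f x * g y) has_sum f x * infsum g B) B" for x
    using assms by (auto intro: has_sum_cmult_right)
  show "(\<lambda>x. f x * infsum g B) summable_on A"
    using assms(1) by (rule summable_on_cmult_left)
qed (use assms in auto)

lemma powr_minus_antimono:
  assumes "0 < y" "y \<le> K * x" "0 < K" "0 < (\<sigma>::real)"
  shows "x powr (-\<sigma>) \<le> K powr \<sigma> * y powr (-\<sigma>)"
proof -
  have x: "x > 0" using assms by (smt (verit) zero_less_mult_iff)
  have "(K * x) powr (-\<sigma>) \<le> y powr (-\<sigma>)"
    using assms by (intro powr_mono2') auto
  hence "K powr \<sigma> * (K * x) powr (-\<sigma>) \<le> K powr \<sigma> * y powr (-\<sigma>)"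
    by (intro mult_left_mono) auto
  moreover have "K powr \<sigma> * (K * x) powr (-\<sigma>) = x powr (-\<sigma>)"
    using assms x by (simp add: powr_mult powr_minus)
  ultimately show ?thesis by simp
qed

text \<open>A form with leading coefficient zero is determined by \<open>b\<close>, \<open>c\<close> and the
  discriminant of its quadratic factor.\<close>

lemma summable_on_reduced_forms:
  assumes s: "\<sigma> > (1::real)"
  shows "(\<lambda>x. \<bar>real_of_int (disc x)\<bar> powr (-\<sigma>)) summable_on reduced_forms"
proof -
  define W where "W = (\<lambda>n::int. (1 + \<bar>real_of_int n\<bar>) powr (-\<sigma>))"
  have W: "W summable_on UNIV" "\<And>n. W n \<ge> 0" using summable_on_int_powr [OF s] by (auto simp: W_def)
  have W2: "(\<lambda>(c,d). W c * W d) summable_on UNIV"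
    using summable_on_product_nonneg [OF W(1) W(1)] W(2) by simp
  have W3: "(\<lambda>(b,y). W b * (case y of (c,d) \<Rightarrow> W c * W d)) summable_on UNIV"
    using summable_on_product_nonneg [OF W(1) W2] W(2) by auto
  have W4: "(\<lambda>(a,z). W a * (case z of (b,y) \<Rightarrow> W b * (case y of (c,d) \<Rightarrow> W c * W d))) summable_on UNIV"
    using summable_on_product_nonneg [OF W(1) W3] W(2) by auto
  define R1 where "R1 = {(a,b,c,d). disc (a,b,c,d) \<noteq> 0 \<and>
     (1 + \<bar>a\<bar>) * (1 + \<bar>b\<bar>) * (1 + \<bar>c\<bar>) * (1 + \<bar>d\<bar>) \<le> 1200 * \<bar>disc (a,b,c,d)\<bar>}"
  define R2 where "R2 = {(a,b,c,d). disc (a,b,c,d) \<noteq> 0 \<and> a = 0 \<and> b \<noteq> 0 \<and> \<bar>c\<bar> \<le> \<bar>b\<bar>}"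
  let ?D = "\<lambda>x. \<bar>real_of_int (disc x)\<bar> powr (-\<sigma>)"
  have 1: "?D summable_on R1"
  proof (rule summable_on_comparison_test)
    show "(\<lambda>x. 1200 powr \<sigma> * (case x of (a,z) \<Rightarrow> W a * (case z of (b,y) \<Rightarrow> W b * (case y of (c,d) \<Rightarrow> W c * W d)))) summable_on R1"
      by (rule summable_on_cmult_right, rule summable_on_subset [OF W4]) simp
    fix x assume x: "x \<in> R1"
    obtain a b c d where e: "x = (a,b,c,d)" by (cases x)
    have "real_of_int ((1 + \<bar>a\<bar>) * (1 + \<bar>b\<bar>) * (1 + \<bar>c\<bar>) * (1 + \<bar>d\<bar>)) \<le> real_of_int (1200 * \<bar>disc x\<bar>)"
      using x unfolding R1_def e by (auto simp del: of_int_mult)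
    hence "(1 + \<bar>real_of_int a\<bar>) * ((1 + \<bar>real_of_int b\<bar>) * ((1 + \<bar>real_of_int c\<bar>) * (1 + \<bar>real_of_int d\<bar>))) \<le> 1200 * \<bar>real_of_int (disc x)\<bar>"
      by (simp add: mult.assoc)
    hence "?D x \<le> 1200 powr \<sigma> * ((1 + \<bar>real_of_int a\<bar>) * ((1 + \<bar>real_of_int b\<bar>) * ((1 + \<bar>real_of_int c\<bar>) * (1 + \<bar>real_of_int d\<bar>)))) powr (-\<sigma>)"
      using s by (intro powr_minus_antimono) (auto intro!: mult_pos_pos)
    thus "?D x \<le> 1200 powr \<sigma> * (case x of (a,z) \<Rightarrow> W a * (case z of (b,y) \<Rightarrow> W b * (case y of (c,d) \<Rightarrow> W c * W d)))"
      by (simp add: e W_def powr_mult)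
  qed simp
  define h where "h = (\<lambda>(a::int,b::int,c::int,d::int). (b, c, c^2 - 4*b*d))"
  have inj: "inj_on h R2" by (auto simp: inj_on_def h_def R2_def)
  have "(\<lambda>(b,y). W b * (case y of (c,d) \<Rightarrow> W c * W d)) summable_on (h ` R2)"
    by (rule summable_on_subset [OF W3]) simp
  hence sh: "((\<lambda>(b,y). W b * (case y of (c,d) \<Rightarrow> W c * W d)) \<circ> h) summable_on R2"
    using inj by (simp add: summable_on_reindex)
  have 2: "?D summable_on R2"
  proof (rule summable_on_comparison_test)
    show "(\<lambda>x. 8 powr \<sigma> * ((\<lambda>(b,y). W b * (case y of (c,d) \<Rightarrow> W c * W d)) \<circ> h) x) summable_on R2"
      using sh by (rule summable_on_cmult_right)
    fix x assume x: "x \<in> R2"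
    obtain a b c d where e: "x = (a,b,c,d)" by (cases x)
    have a: "a = 0" "b \<noteq> 0" "\<bar>c\<bar> \<le> \<bar>b\<bar>" "disc x \<noteq> 0" using x by (auto simp: R2_def e)
    define f where "f = c^2 - 4*b*d"
    have dx: "disc x = b*b*f"
      unfolding e disc_tuple f_def a(1) by (simp add: algebra_simps power2_eq_square power3_eq_cube)
    hence f: "f \<noteq> 0" using a by auto
    \<comment> \<open>As |c| <= |b|, one of the two factors |b| in b^2 |f| pays for c.\<close>
    have "(1 + \<bar>b\<bar>) * ((1 + \<bar>c\<bar>) * (1 + \<bar>f\<bar>)) \<le> (2*\<bar>b\<bar>) * ((2*\<bar>b\<bar>) * (2*\<bar>f\<bar>))"
      using a f by (intro mult_mono) auto
    also have "\<dots> = 8 * \<bar>disc x\<bar>" by (simp add: dx abs_mult)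
    finally have "real_of_int ((1 + \<bar>b\<bar>) * ((1 + \<bar>c\<bar>) * (1 + \<bar>f\<bar>))) \<le> real_of_int (8 * \<bar>disc x\<bar>)"
      by linarith
    hence "(1 + \<bar>real_of_int b\<bar>) * ((1 + \<bar>real_of_int c\<bar>) * (1 + \<bar>real_of_int f\<bar>)) \<le> 8 * \<bar>real_of_int (disc x)\<bar>"
      by simp
    hence "?D x \<le> 8 powr \<sigma> * ((1 + \<bar>real_of_int b\<bar>) * ((1 + \<bar>real_of_int c\<bar>) * (1 + \<bar>real_of_int f\<bar>))) powr (-\<sigma>)"
      using s by (intro powr_minus_antimono) (auto intro!: mult_pos_pos)
    thus "?D x \<le> 8 powr \<sigma> * ((\<lambda>(b,y). W b * (case y of (c,d) \<Rightarrow> W c * W d)) \<circ> h) x"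
      by (simp add: e h_def f_def W_def powr_mult)
  qed simp
  have "?D summable_on (R1 \<union> (R2 - R1))"
    using 1 summable_on_subset [OF 2, of "R2 - R1"] by (intro summable_on_Un_disjoint) auto
  moreover have "reduced_forms \<subseteq> R1 \<union> (R2 - R1)" by (auto simp: reduced_forms_def R1_def R2_def)
  ultimately show ?thesis by (rule summable_on_subset)
qed

section \<open>Orbits and weighted orbit sums\<close>

definition orb :: "form \<Rightarrow> form set" where
  "orb x = {act g x |g. g \<in> SL2Z}"

definition SL2Z_stable :: "form set \<Rightarrow> bool" where
  "SL2Z_stable X \<longleftrightarrow> (\<forall>x\<in>X. \<forall>g\<in>SL2Z. act g x \<in> X)"

text \<open>The same choice as in \<open>xi\<close>, so that the two notions of orbit sum agree by
  unfolding.\<close>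

definition rep :: "form set \<Rightarrow> form" where
  "rep C = (SOME x. x \<in> C)"

lemma orb_self [simp]: "x \<in> orb x"
  unfolding orb_def using act_mone mone_SL2Z by (smt (verit) mem_Collect_eq)

lemma orb_act: "g \<in> SL2Z \<Longrightarrow> orb (act g x) = orb x"
proof -
  have sub: "orb (act g x) \<subseteq> orb x" if "g \<in> SL2Z" for g x
    unfolding orb_def using that act_mm SL2Z_mm by (smt (verit) mem_Collect_eq subsetI)
  assume g: "g \<in> SL2Z"
  have "act (madj g) (act g x) = x" using act_inverse [OF g, of x "act g x"] by simp
  thus ?thesis using sub [OF g, of x] sub [OF SL2Z_madj [OF g], of "act g x"] by auto
qed

lemma orb_eq_iff: "orb x = orb y \<longleftrightarrow> x \<in> orb y"
proof
  assume "orb x = orb y"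
  thus "x \<in> orb y" using orb_self by blast
next
  assume "x \<in> orb y"
  then obtain g where "g \<in> SL2Z" "x = act g y" unfolding orb_def by blast
  thus "orb x = orb y" using orb_act by simp
qed

lemma rep_orb: "\<exists>g\<in>SL2Z. rep (orb x) = act g x"
proof -
  have "rep (orb x) \<in> orb x" unfolding rep_def using orb_self by (rule someI)
  thus ?thesis unfolding orb_def by blast
qed

lemma orb_rep [simp]: "orb (rep (orb x)) = orb x"
  using rep_orb orb_act by metis

lemma disc_rep [simp]: "disc (rep (orb x)) = disc x"
  using rep_orb disc_act_SL2Z by metis

lemma orbits_stable:
  assumes "SL2Z_stable X"
  shows "orbits X = orb ` X"
proof -
  have "orbit_rel X `` {x} = orb x" if "x \<in> X" for x
    using assms that unfolding orbit_rel_def orb_def SL2Z_stable_def by blast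
  thus ?thesis unfolding orbits_def quotient_def by blast
qed

definition classes :: "nat \<Rightarrow> form set set" where
  "classes j = {C \<in> range orb. (-1)^(j-1) * disc (rep C) > 0}"

definition wt :: "complex \<Rightarrow> form set \<Rightarrow> complex" where
  "wt s C = (1 / of_nat (card (stab (rep C)))) * (of_int \<bar>disc (rep C)\<bar> powr (-s))"

definition mass :: "nat \<Rightarrow> complex \<Rightarrow> (form \<Rightarrow> complex) \<Rightarrow> complex" where
  "mass j s \<psi> = (\<Sum>\<^sub>\<infinity>C\<in>classes j. \<psi> (rep C) * wt s C)"

text \<open>This places the zeta functions of all stable sets over the one index set
  \<open>classes j\<close>, so that linear relations between indicators become relations between
  zeta functions. A stable set contains an orbit as soon as it contains its representative.\<close>

lemma xi_eq_mass:
  assumes "SL2Z_stable X"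
  shows "xi X j s = mass j s (indicator X)"
proof -
  have "xi X j s = (\<Sum>\<^sub>\<infinity>C\<in>{C \<in> orb ` X. (-1)^(j-1) * disc (rep C) > 0}. wt s C)"
    unfolding xi_def orbits_stable [OF assms] wt_def rep_def ..
  also have "\<dots> = mass j s (indicator X)"
    unfolding mass_def
  proof (rule infsum_cong_neutral)
    fix C assume "C \<in> classes j - {C \<in> orb ` X. (-1)^(j-1) * disc (rep C) > 0}"
    then obtain x where x: "C = orb x" "C \<notin> orb ` X" by (auto simp: classes_def)
    hence "rep C \<notin> X" by (metis image_eqI orb_rep)
    thus "indicator X (rep C) * wt s C = 0" by simp
  next
    fix C assume "C \<in> {C \<in> orb ` X. (-1)^(j-1) * disc (rep C) > 0} \<inter> classes j"
    then obtain x where x: "C = orb x" "x \<in> X" by auto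
    then obtain g where "g \<in> SL2Z" "rep C = act g x" using rep_orb by blast
    hence "rep C \<in> X" using assms x by (simp add: SL2Z_stable_def)
    thus "wt s C = indicator X (rep C) * wt s C" by simp
  qed (auto simp: classes_def)
  finally show ?thesis .
qed

text \<open>Every class contains a reduced form, and different classes yield different ones, so the
  sum over reduced forms dominates.\<close>

lemma summable_on_wt:
  assumes s: "1 < Re s"
  shows "(\<lambda>C. norm (wt s C)) summable_on classes j"
proof -
  have ex: "\<exists>y. y \<in> reduced_forms \<and> C = orb y \<and> disc y = disc (rep C)" if C: "C \<in> classes j" for C
  proof -
    obtain x where x: "C = orb x" using C unfolding classes_def by blast
    have "disc x \<noteq> 0" using C unfolding x classes_def by (intro notI) simp
    then obtain g where "g \<in> SL2Z" "act g x \<in> reduced_forms" using reduced_representative by blast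
    thus ?thesis using x by (metis disc_rep orb_act)
  qed
  define red where "red C = (SOME y. y \<in> reduced_forms \<and> C = orb y \<and> disc y = disc (rep C))" for C
  have red: "red C \<in> reduced_forms" "C = orb (red C)" "disc (red C) = disc (rep C)"
    if "C \<in> classes j" for C
    using someI_ex [OF ex [OF that]] unfolding red_def by blast+
  have inj: "inj_on red (classes j)" by (metis inj_onI red(2))
  have "(\<lambda>x. \<bar>real_of_int (disc x)\<bar> powr (- Re s)) summable_on (red ` classes j)"
    by (rule summable_on_subset [OF summable_on_reduced_forms [OF s]]) (use red in auto)
  hence sm: "((\<lambda>x. \<bar>real_of_int (disc x)\<bar> powr (- Re s)) \<circ> red) summable_on classes j"
    using inj by (simp add: summable_on_reindex)
  show ?thesis
  proof (rule summable_on_comparison_test [OF sm])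
    fix C assume C: "C \<in> classes j"
    define n where "n = card (stab (rep C))"
    have "norm (wt s C) = (1 / real n) * \<bar>real_of_int (disc (rep C))\<bar> powr (- Re s)"
      unfolding wt_def norm_mult
      by (subst norm_powr_real_powr) (auto simp: n_def norm_divide)
    \<comment> \<open>The bound 1 / n <= 1 covers n = 0 as well, where the quotient is 0.\<close>
    also have "\<dots> \<le> 1 * \<bar>real_of_int (disc (rep C))\<bar> powr (- Re s)"
      by (intro mult_right_mono) (cases n, auto)
    finally show "norm (wt s C) \<le> ((\<lambda>x. \<bar>real_of_int (disc x)\<bar> powr (- Re s)) \<circ> red) C"
      using red(3) [OF C] by simp
  qed simp
qed

section \<open>The Hecke correspondence at two\<close>

definition SL2Z_invariant :: "(form \<Rightarrow> 'a) \<Rightarrow> bool" where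
  "SL2Z_invariant \<psi> \<longleftrightarrow> (\<forall>x. \<forall>g\<in>SL2Z. \<psi> (act g x) = \<psi> x)"

fun fdiv :: "int \<Rightarrow> form \<Rightarrow> form" where
  "fdiv k (a,b,c,d) = (a div k, b div k, c div k, d div k)"

fun fdvd :: "int \<Rightarrow> form \<Rightarrow> bool" where
  "fdvd k (a,b,c,d) \<longleftrightarrow> k dvd a \<and> k dvd b \<and> k dvd c \<and> k dvd d"

lemma fdvd_smul: "fdvd k (smul k y)"
  by (cases y) simp

lemma smul_fdiv: "fdvd k x \<Longrightarrow> smul k (fdiv k x) = x"
  by (cases x) simp

text \<open>For k = 2 this is the operator T of the overview; for k = 4, applied to the constant 1,
  it is the count n.\<close>

definition hecke :: "int \<Rightarrow> (form \<Rightarrow> 'a::real_normed_field) \<Rightarrow> form \<Rightarrow> 'a" where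
  "hecke k \<psi> x = (\<Sum>i<3. if fdvd k (act (hecke_rep i) x) then \<psi> (fdiv k (act (hecke_rep i) x)) else 0)"

text \<open>Here 64 = 2^6: the direction k = 2 multiplies the discriminant by 4, and k = 4 divides
  it by 4.\<close>

lemma disc_hecke_smul: "act (hecke_rep i) x = smul k y \<Longrightarrow> k^4 * disc y = 64 * disc x"
  using disc_act [of "hecke_rep i" x] disc_smul [of k y] by simp

lemma class_orb_iff: "orb x \<in> classes j \<longleftrightarrow> (-1)^(j-1) * disc x > 0"
  by (simp add: classes_def)

lemma has_sum_sum_lessThan:
  fixes f :: "nat \<Rightarrow> 'b \<Rightarrow> 'a::real_normed_vector"
  assumes "\<And>i. i < n \<Longrightarrow> (f i has_sum S i) A"
  shows "((\<lambda>x. \<Sum>i<n. f i x) has_sum (\<Sum>i<n. S i)) A"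
  using assms by (induction n) (auto intro!: has_sum_add)

lemma hecke_idx_iff_orb:
  assumes k: "k \<noteq> 0" and i: "i < 3" and y: "act (hecke_rep i) x = smul k y"
  shows "i \<in> hecke_idx k x z \<longleftrightarrow> orb z = orb y"
proof -
  have "i \<in> hecke_idx k x z \<longleftrightarrow> (\<exists>g\<in>SL2Z. act g y = z)"
    using i k by (simp add: hecke_idx_def act_mm y act_smul smul_inject)
  also have "\<dots> \<longleftrightarrow> z \<in> orb y" unfolding orb_def by blast
  also have "\<dots> \<longleftrightarrow> orb z = orb y" by (simp add: orb_eq_iff)
  finally show ?thesis .
qed

text \<open>Each coset index leads to at most one orbit, so the sum over three indices becomes a sum
  over all classes with a kernel. The target orbit stays in \<open>classes j\<close> because the
  discriminant keeps its sign.\<close>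

lemma has_sum_hecke:
  fixes \<psi> :: "form \<Rightarrow> 'a::real_normed_field"
  assumes k: "k > 0" and inv: "SL2Z_invariant \<psi>" and x: "orb x \<in> classes j"
  shows "((\<lambda>D. of_nat (card (hecke_idx k x (rep D))) * \<psi> (rep D)) has_sum hecke k \<psi> x) (classes j)"
proof -
  have card: "of_nat (card (hecke_idx k x z)) * c = (\<Sum>i<3. if i \<in> hecke_idx k x z then c else 0)" for z and c :: 'a
  proof -
    have "{i \<in> {..<3}. i \<in> hecke_idx k x z} = hecke_idx k x z" by (auto simp: hecke_idx_def)
    thus ?thesis by (simp add: sum.If_cases Int_def)
  qed
  have "((\<lambda>D. if i \<in> hecke_idx k x (rep D) then \<psi> (rep D) else 0) has_sum
        (if fdvd k (act (hecke_rep i) x) then \<psi> (fdiv k (act (hecke_rep i) x)) else 0)) (classes j)"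
    if i: "i < 3" for i
  proof (cases "fdvd k (act (hecke_rep i) x)")
    case True
    define y where "y = fdiv k (act (hecke_rep i) x)"
    have y: "act (hecke_rep i) x = smul k y" using smul_fdiv [OF True] by (simp add: y_def)
    have "k^4 * disc y = 64 * disc x" by (rule disc_hecke_smul [OF y])
    hence "k^4 * ((-1)^(j-1) * disc y) = 64 * ((-1)^(j-1) * disc x)" by simp
    moreover have "\<dots> > 0" using x by (simp add: class_orb_iff)
    ultimately have "k^4 * ((-1)^(j-1) * disc y) > 0" by (simp only:)
    hence cy: "orb y \<in> classes j" using k by (simp add: class_orb_iff zero_less_mult_iff)
    have idx: "i \<in> hecke_idx k x (rep D) \<longleftrightarrow> D = orb y" if "D \<in> classes j" for D
    proof -
      have "orb (rep D) = D" using that unfolding classes_def by auto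
      thus ?thesis using hecke_idx_iff_orb [OF _ i y, of "rep D"] k by simp
    qed
    have py: "\<psi> (rep (orb y)) = \<psi> y" using inv rep_orb [of y] unfolding SL2Z_invariant_def by metis
    show ?thesis
      by (rule has_sum_finite_neutralI [of "{orb y}"])
         (use cy idx py True in \<open>auto simp: y_def\<close>)
  next
    case False
    have "i \<notin> hecke_idx k x z" for z
    proof
      assume "i \<in> hecke_idx k x z"
      then obtain g where g: "g \<in> SL2Z" "act g (act (hecke_rep i) x) = smul k z"
        unfolding hecke_idx_def act_mm by blast
      hence "act (hecke_rep i) x = smul k (act (madj g) z)"
        using act_inverse act_smul by metis
      thus False using False fdvd_smul by metis
    qed
    thus ?thesis using False by (simp add: has_sum_0)
  qed
  hence "((\<lambda>D. \<Sum>i<3. if i \<in> hecke_idx k x (rep D) then \<psi> (rep D) else 0) has_sum hecke k \<psi> x) (classes j)"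
    unfolding hecke_def by (rule has_sum_sum_lessThan)
  thus ?thesis by (simp add: card)
qed

text \<open>This is \<open>hecke_kernel\<close> with the discriminants included;
  \<open>4 powr s\<close> comes from P(y) = 4 P(x).\<close>

lemma wt_kernel:
  assumes CD: "C \<in> classes j" "D \<in> classes j"
  shows "of_nat (card (hecke_idx 2 (rep C) (rep D))) * wt s C
    = 4 powr s * (of_nat (card (hecke_idx 4 (rep D) (rep C))) * wt s D)"
proof (cases "hecke_idx 2 (rep C) (rep D) = {}")
  case True
  \<comment> \<open>The right-hand side vanishes too: either its index set is empty, or the
    stabilizer is infinite and the weight is zero.\<close>
  have "card (hecke_idx 4 (rep D) (rep C)) = 0 \<or> card (stab (rep D)) = 0"
    using hecke_kernel [of "rep C" "rep D"] by (simp add: True)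
  thus ?thesis by (auto simp: True wt_def)
next
  case False
  then obtain i g where i: "g \<in> SL2Z" "act (mm (hecke_rep i) g) (rep C) = smul 2 (rep D)"
    unfolding hecke_idx_def by blast
  have "64 * disc (rep C) = 16 * disc (rep D)"
    using disc_act [of "mm (hecke_rep i) g" "rep C"] i disc_smul [of 2 "rep D"]
    by (simp add: mdet_mm SL2Z_iff_mdet)
  hence d: "disc (rep D) = 4 * disc (rep C)" by simp
  define p :: complex where "p = of_int \<bar>disc (rep C)\<bar> powr (-s)"
  define q :: complex where "q = of_int \<bar>disc (rep D)\<bar> powr (-s)"
  have "q = (4 * of_int \<bar>disc (rep C)\<bar>) powr (-s)" by (simp add: q_def d abs_mult)
  also have "\<dots> = 4 powr (-s) * p"
    unfolding p_def by (rule powr_times_real_left) simp_all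
  finally have pq: "p = 4 powr s * q" by (simp add: powr_minus)
  have "of_nat (card (hecke_idx 2 (rep C) (rep D))) * wt s C
      = p * (of_nat (card (hecke_idx 2 (rep C) (rep D))) / of_nat (card (stab (rep C))))"
    by (simp add: wt_def p_def)
  also have "\<dots> = 4 powr s * (of_nat (card (hecke_idx 4 (rep D) (rep C))) * wt s D)"
    unfolding hecke_kernel pq by (simp add: wt_def q_def)
  finally show ?thesis .
qed

lemma hecke_bound:
  fixes \<psi> :: "form \<Rightarrow> real"
  assumes "\<And>x. 0 \<le> \<psi> x" "\<And>x. \<psi> x \<le> K"
  shows "0 \<le> hecke k \<psi> x" "hecke k \<psi> x \<le> 3 * K"
proof -
  show "0 \<le> hecke k \<psi> x" unfolding hecke_def using assms(1) by (intro sum_nonneg) simp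
  have "K \<ge> 0" using order_trans [OF assms(1) assms(2)] .
  have "hecke k \<psi> x \<le> (\<Sum>i<(3::nat). K)"
    unfolding hecke_def using assms(2) \<open>K \<ge> 0\<close> by (intro sum_mono) simp
  thus "hecke k \<psi> x \<le> 3 * K" by simp
qed

text \<open>Written as a double sum over classes, the left side can be rearranged because T of a
  function bounded by \<open>K\<close> is bounded by \<open>3 * K\<close>. After
  \<open>wt_kernel\<close> moves the weight to the target class, the inner sum is the count
  n.\<close>

lemma mass_hecke:
  assumes s: "1 < Re s" and inv: "SL2Z_invariant \<psi>" and bd: "\<And>x. norm (\<psi> x) \<le> K"
  shows "mass j s (hecke 2 \<psi>) = 4 powr s * mass j s (\<lambda>y. \<psi> y * hecke 4 (\<lambda>_. 1) y)"
proof -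
  define F where "F C D = of_nat (card (hecke_idx 2 (rep C) (rep D))) * \<psi> (rep D) * wt s C" for C D
  have orb: "orb (rep C) \<in> classes j" if "C \<in> classes j" for C
    using that unfolding classes_def by auto
  have hs: "((\<lambda>D. F C D) has_sum hecke 2 \<psi> (rep C) * wt s C) (classes j)" if "C \<in> classes j" for C
    unfolding F_def using has_sum_hecke [OF _ inv orb [OF that], of 2]
    by (intro has_sum_cmult_left) simp
  have hn: "((\<lambda>D. norm (F C D)) has_sum hecke 2 (\<lambda>x. norm (\<psi> x)) (rep C) * norm (wt s C)) (classes j)"
    if "C \<in> classes j" for C
  proof -
    have "SL2Z_invariant (\<lambda>x. norm (\<psi> x))" using inv by (simp add: SL2Z_invariant_def)
    from has_sum_hecke [OF _ this orb [OF that], of 2]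
    have "((\<lambda>D. of_nat (card (hecke_idx 2 (rep C) (rep D))) * norm (\<psi> (rep D)))
        has_sum hecke 2 (\<lambda>x. norm (\<psi> x)) (rep C)) (classes j)" by simp
    from has_sum_cmult_left [OF this, of "norm (wt s C)"] show ?thesis
      by (simp add: F_def norm_mult)
  qed
  have sm: "(\<lambda>C. hecke 2 (\<lambda>x. norm (\<psi> x)) (rep C) * norm (wt s C)) summable_on classes j"
  proof (rule summable_on_comparison_test)
    show "(\<lambda>C. 3 * K * norm (wt s C)) summable_on classes j"
      using summable_on_wt [OF s] by (rule summable_on_cmult_right)
    show "hecke 2 (\<lambda>x. norm (\<psi> x)) (rep C) * norm (wt s C) \<le> 3 * K * norm (wt s C)"
      "0 \<le> hecke 2 (\<lambda>x. norm (\<psi> x)) (rep C) * norm (wt s C)" for C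
      using hecke_bound [of "\<lambda>x. norm (\<psi> x)" K, OF norm_ge_zero bd]
      by (simp_all add: mult_right_mono)
  qed
  have "(\<lambda>CD. norm (case CD of (C,D) \<Rightarrow> F C D)) summable_on classes j \<times> classes j"
    by (rule summable_on_SigmaI [OF _ sm]) (use hn in auto)
  hence "(\<lambda>(C,D). F C D) summable_on classes j \<times> classes j"
    by (rule abs_summable_summable)
  hence sw: "(\<Sum>\<^sub>\<infinity>C\<in>classes j. \<Sum>\<^sub>\<infinity>D\<in>classes j. F C D) = (\<Sum>\<^sub>\<infinity>D\<in>classes j. \<Sum>\<^sub>\<infinity>C\<in>classes j. F C D)"
    by (rule infsum_swap_banach)
  have "mass j s (hecke 2 \<psi>) = (\<Sum>\<^sub>\<infinity>C\<in>classes j. \<Sum>\<^sub>\<infinity>D\<in>classes j. F C D)"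
    unfolding mass_def by (rule infsum_cong) (use hs infsumI in metis)
  also note sw
  also have "(\<Sum>\<^sub>\<infinity>D\<in>classes j. \<Sum>\<^sub>\<infinity>C\<in>classes j. F C D)
      = (\<Sum>\<^sub>\<infinity>D\<in>classes j. 4 powr s * (\<psi> (rep D) * hecke 4 (\<lambda>_. 1) (rep D) * wt s D))"
  proof (rule infsum_cong)
    fix D assume D: "D \<in> classes j"
    have "SL2Z_invariant (\<lambda>_. 1 :: complex)" by (simp add: SL2Z_invariant_def)
    from has_sum_hecke [OF _ this orb [OF D], of 4]
    have "((\<lambda>C. of_nat (card (hecke_idx 4 (rep D) (rep C)))) has_sum hecke 4 (\<lambda>_. 1 :: complex) (rep D)) (classes j)"
      by simp
    from has_sum_cmult_right [OF this, of "4 powr s * \<psi> (rep D) * wt s D"]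
    have "((\<lambda>C. F C D) has_sum 4 powr s * \<psi> (rep D) * wt s D * hecke 4 (\<lambda>_. 1) (rep D)) (classes j)"
    proof (rule has_sum_cong [THEN iffD1, rotated])
      fix C assume "C \<in> classes j"
      from wt_kernel [OF this D, of s]
      show "4 powr s * \<psi> (rep D) * wt s D * of_nat (card (hecke_idx 4 (rep D) (rep C))) = F C D"
        unfolding F_def by (simp add: mult.commute mult.left_commute)
    qed
    from infsumI [OF this]
    show "(\<Sum>\<^sub>\<infinity>C\<in>classes j. F C D) = 4 powr s * (\<psi> (rep D) * hecke 4 (\<lambda>_. 1) (rep D) * wt s D)"
      by (simp add: mult_ac)
  qed
  also have "\<dots> = 4 powr s * mass j s (\<lambda>y. \<psi> y * hecke 4 (\<lambda>_. 1) y)"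
    unfolding mass_def by (rule infsum_cmult_right')
  finally show ?thesis .
qed

text \<open>Doubling matches all classes with the classes of even forms; it multiplies the
  discriminant by 16 and keeps the stabilizer.\<close>

lemma mass_even_forms:
  assumes inv: "SL2Z_invariant \<psi>"
  shows "mass j s (\<lambda>x. if fdvd 2 x then \<psi> (fdiv 2 x) else 0) = 16 powr (-s) * mass j s \<psi>"
proof -
  let ?E = "{C \<in> classes j. fdvd 2 (rep C)}"
  have fdvd_act: "fdvd 2 (act g x)" if "fdvd 2 x" for g x
    using that by (metis act_smul fdvd_smul smul_fdiv)
  have bij: "bij_betw (\<lambda>C. orb (smul 2 (rep C))) (classes j) ?E"
  proof (rule bij_betwI')
    fix C D assume "C \<in> classes j" "D \<in> classes j"
    hence CD: "C = orb (rep C)" "D = orb (rep D)" unfolding classes_def by auto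
    have "C = D" if "orb (smul 2 (rep C)) = orb (smul 2 (rep D))"
    proof -
      have "smul 2 (rep C) \<in> orb (smul 2 (rep D))" using that by (simp add: orb_eq_iff)
      then obtain g where "g \<in> SL2Z" "smul 2 (rep C) = act g (smul 2 (rep D))"
        unfolding orb_def by blast
      hence "rep C = act g (rep D)" by (simp add: act_smul smul_inject)
      thus ?thesis using CD \<open>g \<in> SL2Z\<close> orb_act by metis
    qed
    thus "orb (smul 2 (rep C)) = orb (smul 2 (rep D)) \<longleftrightarrow> C = D" by auto
  next
    fix C assume C: "C \<in> classes j"
    hence "(-1)^(j-1) * disc (rep C) > 0" by (simp add: classes_def)
    hence "orb (smul 2 (rep C)) \<in> classes j" by (simp add: class_orb_iff disc_smul mult.commute)
    moreover obtain g where "rep (orb (smul 2 (rep C))) = act g (smul 2 (rep C))"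
      using rep_orb by blast
    ultimately show "orb (smul 2 (rep C)) \<in> ?E" using fdvd_act fdvd_smul by simp
  next
    fix D assume D: "D \<in> ?E"
    define y where "y = fdiv 2 (rep D)"
    have y: "smul 2 y = rep D" using D by (simp add: y_def smul_fdiv)
    have D': "D = orb (rep D)" using D unfolding classes_def by auto
    have "(-1)^(j-1) * disc (smul 2 y) > 0" using D unfolding y classes_def by simp
    hence c: "orb y \<in> classes j" by (simp add: class_orb_iff disc_smul mult.commute)
    obtain g where g: "g \<in> SL2Z" "rep (orb y) = act g y" using rep_orb by blast
    have "D = orb (smul 2 (rep (orb y)))"
      unfolding g(2) act_smul [symmetric] orb_act [OF g(1)] y by (rule D')
    thus "\<exists>C\<in>classes j. D = orb (smul 2 (rep C))" using c by blast
  qed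
  have "mass j s (\<lambda>x. if fdvd 2 x then \<psi> (fdiv 2 x) else 0)
      = (\<Sum>\<^sub>\<infinity>C\<in>?E. \<psi> (fdiv 2 (rep C)) * wt s C)"
    unfolding mass_def by (rule infsum_cong_neutral) auto
  also have "\<dots> = (\<Sum>\<^sub>\<infinity>C\<in>classes j. \<psi> (fdiv 2 (rep (orb (smul 2 (rep C))))) * wt s (orb (smul 2 (rep C))))"
    using bij by (rule infsum_reindex_bij_betw [symmetric])
  also have "\<dots> = (\<Sum>\<^sub>\<infinity>C\<in>classes j. 16 powr (-s) * (\<psi> (rep C) * wt s C))"
  proof (rule infsum_cong)
    fix C assume C: "C \<in> classes j"
    define D where "D = orb (smul 2 (rep C))"
    obtain g where g: "g \<in> SL2Z" "rep D = act g (smul 2 (rep C))" unfolding D_def using rep_orb by blast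
    have rD: "rep D = smul 2 (act g (rep C))" using g by (simp add: act_smul)
    have f: "fdiv 2 (rep D) = act g (rep C)"
      using smul_fdiv [OF fdvd_smul, of 2 "act g (rep C)"] unfolding rD by (simp add: smul_inject)
    \<comment> \<open>The representative of the doubled class agrees with the doubled representative
      only up to \<open>g\<close>, so stabilizers are compared by conjugation.\<close>
    have st: "card (stab (act g x)) = card (stab x)" for x
    proof (rule bij_betw_same_card [symmetric])
      show "bij_betw (\<lambda>h. mm (madj g) (mm h g)) (stab x) (stab (act g x))"
      proof (rule bij_betw_byWitness [where f' = "\<lambda>h. mm g (mm h (madj g))"])
        have gg: "mm g (madj g) = mone" "mm (madj g) g = mone"
          using g(1) mm_madj by (simp_all add: SL2Z_iff_mdet)
        have gg': "mm g (mm (madj g) z) = z" "mm (madj g) (mm g z) = z" for z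
          by (simp_all add: mm_assoc [symmetric] gg)
        show "\<forall>a\<in>stab x. mm g (mm (mm (madj g) (mm a g)) (madj g)) = a"
          "\<forall>a\<in>stab (act g x). mm (madj g) (mm (mm g (mm a (madj g))) g) = a"
          by (simp_all add: mm_assoc gg gg')
        have ag: "act (madj g) (act g z) = z" for z using act_inverse [OF g(1), of z "act g z"] by simp
        show "(\<lambda>h. mm (madj g) (mm h g)) ` stab x \<subseteq> stab (act g x)"
          using g(1) by (intro image_subsetI) (simp add: stab_def act_mm ag SL2Z_mm SL2Z_madj)
        show "(\<lambda>h. mm g (mm h (madj g))) ` stab (act g x) \<subseteq> stab x"
          using g(1) by (intro image_subsetI) (simp add: stab_def act_mm ag SL2Z_mm SL2Z_madj)
      qed
    qed
    have "stab (smul 2 x) = stab x" for x by (simp add: stab_def act_smul smul_inject)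
    hence "card (stab (rep D)) = card (stab (rep C))" by (simp add: rD st)
    moreover have "(of_int \<bar>disc (rep D)\<bar> :: complex) powr (-s) = 16 powr (-s) * of_int \<bar>disc (rep C)\<bar> powr (-s)"
    proof -
      have "disc (rep D) = 16 * disc (rep C)" using g by (simp add: rD disc_smul disc_act_SL2Z)
      hence "(of_int \<bar>disc (rep D)\<bar> :: complex) = 16 * of_int \<bar>disc (rep C)\<bar>" by (simp add: abs_mult)
      thus ?thesis by (simp only:) (rule powr_times_real_left, simp_all)
    qed
    ultimately have "wt s D = 16 powr (-s) * wt s C" by (simp add: wt_def)
    moreover have "\<psi> (fdiv 2 (rep D)) = \<psi> (rep C)" unfolding f using inv g(1) unfolding SL2Z_invariant_def by blast
    ultimately show "\<psi> (fdiv 2 (rep (orb (smul 2 (rep C))))) * wt s (orb (smul 2 (rep C)))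
        = 16 powr (-s) * (\<psi> (rep C) * wt s C)" unfolding D_def by simp
  qed
  also have "\<dots> = 16 powr (-s) * mass j s \<psi>" unfolding mass_def by (rule infsum_cmult_right')
  finally show ?thesis .
qed

section \<open>Congruences modulo powers of two\<close>

lemma odd_square_mod_8:
  assumes "odd (n::int)"
  obtains w where "n^2 = 8*w + 1"
proof -
  obtain m where m: "n = 2*m + 1" using assms by (rule oddE)
  have "even (m*(m+1))" by simp
  then obtain w where "m*(m+1) = 2*w" by (rule evenE)
  hence "n^2 = 8*w + 1" unfolding m by (simp add: power2_eq_square algebra_simps)
  thus ?thesis by (rule that)
qed

lemma mod_eqI: "n = N * k + r \<Longrightarrow> 0 \<le> r \<Longrightarrow> r < N \<Longrightarrow> n mod N = r" for n N k r :: int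
  by simp

lemma disc_swap: "disc (d,c,b,a) = disc (a,b,c,d)"
  by (simp add: disc_tuple)

text \<open>The substitution v -> u + v brings the point (1,1) to (1,0). Together with
  \<open>disc_swap\<close> it lets statements about one root modulo 2 serve for all three
  points.\<close>

lemma disc_shift: "disc (a+b+c+d, b+2*c+3*d, c+3*d, d) = disc (a,b,c,d)"
proof -
  have "act (1,0,1,1) (a,b,c,d) = (a+b+c+d, b+2*c+3*d, c+3*d, d)" by (simp add: act_tuple)
  thus ?thesis using disc_act_SL2Z [of "(1,0,1,1)" "(a,b,c,d)"] by (simp add: SL2Z_def)
qed

text \<open>Modulo 2 the form is u v (u + v).\<close>

lemma disc_split:
  assumes "even a" "even d" "odd b" "odd c"
  shows "disc (a,b,c,d) mod 8 = 1"
proof -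
  obtain a' d' where a: "a = 2*a'" "d = 2*d'" using assms by (metis evenE)
  obtain w where w: "(b*c)^2 = 8*w + 1" using odd_square_mod_8 assms by (metis even_mult_iff)
  have "disc (a,b,c,d) = (b*c)^2 + 8 * (9*a'*b*c*d' - a'*c^3 - b^3*d' - 54*a'^2*d'^2)"
    unfolding disc_tuple a by algebra
  also have "\<dots> = 8 * (w + (9*a'*b*c*d' - a'*c^3 - b^3*d' - 54*a'^2*d'^2)) + 1"
    unfolding w by algebra
  finally show ?thesis by (rule mod_eqI) simp_all
qed

text \<open>Modulo 2 the form is v (u^2 + u v + v^2).\<close>

lemma disc_linear_times_irreducible:
  assumes "even a" "odd b" "odd c" "odd d"
  shows "disc (a,b,c,d) mod 8 = 5"
proof -
  obtain a' where a: "a = 2*a'" using assms by (metis evenE)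
  obtain w where w: "(b*c)^2 = 8*w + 1" using odd_square_mod_8 assms by (metis even_mult_iff)
  obtain j where j: "b*c*d = 2*j + 1" using assms by (metis even_mult_iff oddE)
  obtain k where k: "b^3*d = 2*k + 1" using assms by (metis even_mult_iff even_power oddE)
  obtain l where l: "d^2 = 2*l + 1" using assms by (metis even_power oddE)
  have "even (a'*(a'-1))" by simp
  then obtain t where t: "a'*(a'-1) = 2*t" by (rule evenE)
  have "disc (a,b,c,d) = (b*c)^2 + 36*a'*(b*c*d) - 8*a'*c^3 - 4*(b^3*d) - 108*a'^2*d^2"
    unfolding disc_tuple a by algebra
  also have "\<dots> = 8 * (w + 9*a'*j - a'*c^3 - k - 27*a'^2*l - 9*t - 9*a'^2 - 1) + 5"
    unfolding w j k l using t by algebra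
  finally show ?thesis by (rule mod_eqI) simp_all
qed

text \<open>Modulo 2 the form is u^3, and its value at the triple root (0,1) is 2 modulo 4.\<close>

lemma disc_triple_root:
  assumes "odd a" "even b" "even c" "d mod 4 = 2"
  shows "disc (a,b,c,d) mod 32 = 20"
proof -
  obtain b' c' where b: "b = 2*b'" "c = 2*c'" using assms by (metis evenE)
  define d' where "d' = d div 2"
  have d: "d = 2*d'" and "odd d'" using assms(4) unfolding d'_def by presburger+
  hence o: "odd (a*d')" using assms(1) by simp
  then obtain j where j: "a*d' = 2*j + 1" by (rule oddE)
  obtain w where w: "(a*d')^2 = 8*w + 1" using odd_square_mod_8 o by metis
  define m where "m = b'*c'"
  have "even (m*(m+1))" by simp
  then obtain k where k: "m*(m+1) = 2*k" by (rule evenE)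
  have "disc (a,b,c,d) = 16*m^2 + 144*(a*d')*m - 32*a*c'^3 - 64*b'^3*d' - 108*(a*d')^2"
    unfolding disc_tuple b d m_def by algebra
  also have "\<dots> = 32 * (k + 9*j*m + 4*m - a*c'^3 - 2*b'^3*d' - 27*w - 4) + 20"
    unfolding w unfolding j using k by algebra
  finally show ?thesis by (rule mod_eqI) simp_all
qed

text \<open>Modulo 2 the form is u^2 (a u + v), and its value at the double root (0,1) is 2 modulo
  4. What survives modulo 16 is 4 (c' + a)^2 - 8, which is 8 or 12.\<close>

lemma disc_double_root:
  assumes "odd b" "even c" "d mod 4 = 2"
  shows "disc (a,b,c,d) mod 16 \<noteq> 4"
proof -
  obtain c' where c: "c = 2*c'" using assms by (metis evenE)
  define d' where "d' = d div 2"
  have d: "d = 2*d'" and od: "odd d'" using assms(3) unfolding d'_def by presburger+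
  obtain j where j: "b*d' = 2*j + 1" using assms od by (metis even_mult_iff oddE)
  obtain k where k: "b^3*d' = 2*k + 1" using assms od by (metis even_mult_iff even_power oddE)
  obtain w where w: "b^2 = 8*w + 1" using odd_square_mod_8 assms(1) by metis
  obtain v where v: "d'^2 = 8* v + 1" using odd_square_mod_8 od by metis
  have "disc (a,b,c,d) = 4*b^2*c'^2 + 72*a*c'*(b*d') - 32*a*c'^3 - 8*(b^3*d') - 108*a^2*d'^2"
    unfolding disc_tuple c d by algebra
  also have "\<dots> = 16 * (2*w*c'^2 + 9*a*c'*j + 4*a*c' - 2*a*c'^3 - k - 54*a^2* v - 7*a^2)
      + 4*(c' + a)^2 - 8"
    unfolding w v j k by algebra
  finally have e: "disc (a,b,c,d) = 16 * (2*w*c'^2 + 9*a*c'*j + 4*a*c' - 2*a*c'^3 - k - 54*a^2* v - 7*a^2)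
      + 4*(c' + a)^2 - 8" .
  define K where "K = 2*w*c'^2 + 9*a*c'*j + 4*a*c' - 2*a*c'^3 - k - 54*a^2* v - 7*a^2"
  note e = e [folded K_def]
  show ?thesis
  proof (cases "even (c' + a)")
    case True
    then obtain y where "c' + a = 2*y" by (rule evenE)
    hence "(c' + a)^2 = 4*y^2" by (simp add: power_mult_distrib)
    hence "disc (a,b,c,d) = 16 * (K + y^2 - 1) + 8" unfolding e by simp
    hence "disc (a,b,c,d) mod 16 = 8" by (rule mod_eqI) simp_all
    thus ?thesis by simp
  next
    case False
    then obtain y where "(c' + a)^2 = 8*y + 1" using odd_square_mod_8 by metis
    hence "disc (a,b,c,d) = 16 * (K + 2*y - 1) + 12" unfolding e by simp
    hence "disc (a,b,c,d) mod 16 = 12" by (rule mod_eqI) simp_all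
    thus ?thesis by simp
  qed
qed

section \<open>Local counts for the correspondence\<close>

lemma act_hecke_reps:
  "act (hecke_rep 0) (a,b,c,d) = (a, 2*b, 4*c, 8*d)"
  "act (hecke_rep (Suc 0)) (a,b,c,d) = (8*a, 4*b, 2*c, d)"
  "act (hecke_rep 2) (a,b,c,d) = (a+b+c+d, 2*(b+2*c+3*d), 4*(c+3*d), 8*d)"
  by (simp_all add: hecke_rep_def act_tuple)

lemma hecke_tuple_2:
  "hecke 2 \<psi> (a,b,c,d) =
     (if even a then \<psi> (a div 2, b, 2*c, 4*d) else 0)
   + (if even d then \<psi> (4*a, 2*b, c, d div 2) else 0)
   + (if even (a+b+c+d) then \<psi> ((a+b+c+d) div 2, b+2*c+3*d, 2*(c+3*d), 4*d) else 0)"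
proof -
  have [simp]: "(4 * x) div 2 = 2 * x" "(8 * x) div 2 = 4 * x" for x :: int by simp_all
  have "{..<3} = {0, 1, 2::nat}" by auto
  thus ?thesis unfolding hecke_def by (simp add: act_hecke_reps)
qed

text \<open>Each term tests one point of the projective line over F_2: it must be a multiple root
  modulo 2 at which the value of the form is divisible by 4.\<close>

lemma hecke_4_one:
  "hecke 4 (\<lambda>_. 1) (a,b,c,d) =
     of_bool (4 dvd a \<and> even b) + of_bool (4 dvd d \<and> even c) + of_bool (4 dvd (a+b+c+d) \<and> even (b+d))"
proof -
  have 2: "4 dvd 2 * y \<longleftrightarrow> even y" for y :: int
    using dvd_mult_cancel_left [of 2 2 y] by simp
  have 48: "4 dvd 4 * y" "4 dvd 8 * y" for y :: int
    using dvd_triv_left [of 4 "2 * y"] by simp_all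
  have "even (b + 2*c + 3*d) \<longleftrightarrow> even (b + d)" by simp
  hence "fdvd 4 (act (hecke_rep 0) (a,b,c,d)) \<longleftrightarrow> 4 dvd a \<and> even b"
    "fdvd 4 (act (hecke_rep (Suc 0)) (a,b,c,d)) \<longleftrightarrow> 4 dvd d \<and> even c"
    "fdvd 4 (act (hecke_rep 2) (a,b,c,d)) \<longleftrightarrow> 4 dvd (a+b+c+d) \<and> even (b+d)"
    unfolding act_hecke_reps fdvd.simps 2 using 48 by blast+
  moreover have "{..<3} = {0, Suc 0, 2::nat}" by auto
  ultimately show ?thesis unfolding hecke_def by (simp del: even_add add: of_bool_def)
qed

definition Lzero :: "form set" where
  "Lzero = {x. fdvd 2 x}"

text \<open>Modulo 2, \<open>L5\<close> consists of zero and the split form, \<open>L2\<close> of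
  zero and the products of a linear and an irreducible quadratic form, \<open>L3\<close> of zero,
  the split form and the irreducible cubics. \<open>L4\<close> consists of \<open>L2\<close>,
  \<open>L5\<close> and the cubes of linear forms, so exactly the nonzero cubes remain here.\<close>

definition Ltriple :: "form set" where
  "Ltriple = L4 - L2 - L5"

lemmas lattice_defs = L2_def L3_def L4_def L5_def Lzero_def Ltriple_def

text \<open>The left side counts roots modulo 2: three for the zero and the split form, two in the
  presence of a double root, one for a cube or a linear times an irreducible factor, none for an
  irreducible form.\<close>

lemma hecke_2_one:
  "hecke 2 (\<lambda>_. 1) x =
     (2 - 2 * indicator L3 x - indicator L4 x + 4 * indicator L5 x :: complex)"
proof -
  obtain a b c d where x: "x = (a,b,c,d)" by (cases x)
  show ?thesis unfolding x hecke_tuple_2 indicator_def lattice_defs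
    by (cases "even a"; cases "even b"; cases "even c"; cases "even d") simp_all
qed

lemma indicator_Ltriple:
  "indicator Ltriple x = (indicator L4 x - indicator L2 x - indicator L5 x + indicator Lzero x :: complex)"
proof -
  obtain a b c d where x: "x = (a,b,c,d)" by (cases x)
  show ?thesis unfolding x indicator_def lattice_defs
    by (cases "even a"; cases "even b"; cases "even c"; cases "even d") simp_all
qed

text \<open>A root leads to a form in \<open>Ltriple\<close> exactly when it is a multiple root with
  value 2 modulo 4. Hence the result is the number of multiple roots modulo 2, expressed by the
  lattice indicators, minus those counted by n.\<close>

lemma hecke_2_Ltriple:
  "hecke 2 (indicator Ltriple) x =
     (1 - indicator L2 x - indicator L3 x + 4 * indicator Lzero x - hecke 4 (\<lambda>_. 1) x :: complex)"
proof -
  obtain a b c d where x: "x = (a,b,c,d)" by (cases x)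
  have "(a div 2, b, 2*c, 4*d) \<in> Ltriple \<longleftrightarrow> even b \<and> \<not> 4 dvd a" if "even a"
    using that by (elim evenE) (auto simp: lattice_defs)
  moreover have "(4*a, 2*b, c, d div 2) \<in> Ltriple \<longleftrightarrow> even c \<and> \<not> 4 dvd d" if "even d"
    using that by (elim evenE) (auto simp: lattice_defs)
  moreover have "((a+b+c+d) div 2, b+2*c+3*d, 2*(c+3*d), 4*d) \<in> Ltriple \<longleftrightarrow>
      even (b+d) \<and> \<not> 4 dvd (a+b+c+d)" if "even (a+b+c+d)"
    using that by (elim evenE) (auto simp: lattice_defs)
  ultimately have "hecke 2 (indicator Ltriple) x =
      (of_bool (even a \<and> even b \<and> \<not> 4 dvd a) + of_bool (even d \<and> even c \<and> \<not> 4 dvd d)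
      + of_bool (even (a+b+c+d) \<and> even (b+d) \<and> \<not> 4 dvd (a+b+c+d)) :: complex)"
    unfolding x hecke_tuple_2 indicator_def by (auto simp: of_bool_def)
  also have "\<dots> = of_bool (even a \<and> even b) + of_bool (even c \<and> even d)
      + of_bool (even (a+b+c+d) \<and> even (b+d)) - hecke 4 (\<lambda>_. 1) x"
  proof -
    have e: "of_bool (even z \<and> P \<and> \<not> 4 dvd z) = (of_bool (even z \<and> P) - of_bool (4 dvd z \<and> P) :: complex)"
      for z :: int and P
    proof -
      have "4 dvd z \<Longrightarrow> even z" by presburger
      thus ?thesis by (cases "4 dvd z"; cases P) simp_all
    qed
    show ?thesis unfolding x hecke_4_one e by (simp only: conj_commute [of "even d"] algebra_simps)
  qed
  also have "of_bool (even a \<and> even b) + of_bool (even c \<and> even d) + of_bool (even (a+b+c+d) \<and> even (b+d))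
      = (1 - indicator L2 x - indicator L3 x + 4 * indicator Lzero x :: complex)"
    unfolding x indicator_def lattice_defs
    by (cases "even a"; cases "even b"; cases "even c"; cases "even d") simp_all
  finally show ?thesis .
qed

definition disc_class :: "int \<Rightarrow> int \<Rightarrow> form set" where
  "disc_class l N = {x. disc x mod N = l}"

text \<open>As P(y) = 4 P(x), either all y reached from x lie in the class or none does.\<close>

lemma hecke_2_disc_class:
  fixes m :: int
  shows "hecke 2 (indicator (disc_class (4*m) 32)) x
    = (indicator (disc_class m 8) x * hecke 2 (\<lambda>_. 1) x :: complex)"
proof -
  have "indicator (disc_class (4*m) 32) (fdiv 2 (act (hecke_rep i) x)) = (indicator (disc_class m 8) x :: complex)"
    if "fdvd 2 (act (hecke_rep i) x)" for i
  proof -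
    have "act (hecke_rep i) x = smul 2 (fdiv 2 (act (hecke_rep i) x))" using that by (simp add: smul_fdiv)
    from disc_hecke_smul [OF this] have "disc (fdiv 2 (act (hecke_rep i) x)) = 4 * disc x" by simp
    moreover have "(4 * disc x) mod 32 = 4 * (disc x mod 8)"
      using mult_mod_right [of 4 "disc x" 8] by simp
    ultimately show ?thesis by (simp add: indicator_def disc_class_def)
  qed
  hence "hecke 2 (indicator (disc_class (4*m) 32)) x =
      (\<Sum>i<3. indicator (disc_class m 8) x * (if fdvd 2 (act (hecke_rep i) x) then 1 else 0 :: complex))"
    unfolding hecke_def by (intro sum.cong) auto
  also have "\<dots> = indicator (disc_class m 8) x * hecke 2 (\<lambda>_. 1) x"
    unfolding hecke_def by (simp add: sum_distrib_left)
  finally show ?thesis .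
qed

text \<open>The left sides are root counts restricted to P = 1 or P = 5 modulo 8. Forms without a
  root drop out, so of the odd discriminants only the split type (P = 1, three roots) and linear
  times irreducible (P = 5, one root) contribute.\<close>

lemma hecke_2_disc_class_4_20:
  "hecke 2 (indicator (disc_class 4 32)) x = (3 * (indicator L5 x - indicator Lzero x) :: complex)" (is ?A)
  "hecke 2 (indicator (disc_class 20 32)) x = (indicator L2 x - indicator Lzero x :: complex)" (is ?B)
proof -
  obtain a b c d where x: "x = (a,b,c,d)" by (cases x)
  define P Q where "P \<longleftrightarrow> disc x mod 8 = 1" and "Q \<longleftrightarrow> disc x mod 8 = 5"
  have f0: "\<not> P \<and> \<not> Q" if "(odd b \<and> odd c) = (odd a \<and> odd d)"
  proof -
    have "even (disc x)" using that by (simp add: x disc_tuple) blast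
    thus ?thesis unfolding P_def Q_def by presburger
  qed
  have f1: "P \<and> \<not> Q" if "even a" "odd b" "odd c" "even d"
    using disc_split that by (simp add: P_def Q_def x)
  have f2: "\<not> P \<and> Q" if "even a" "odd b" "odd c" "odd d"
    using disc_linear_times_irreducible that by (simp add: P_def Q_def x)
  have f3: "\<not> P \<and> Q" if "odd a" "odd b" "odd c" "even d"
    using disc_linear_times_irreducible [of d c b a] that by (simp add: P_def Q_def x disc_swap)
  have f4: "\<not> P \<and> Q" if "odd a" "even b" "even c" "odd d"
    using disc_linear_times_irreducible [of "a+b+c+d" "b+2*c+3*d" "c+3*d" d] that
    by (simp add: P_def Q_def x disc_shift)
  have ind: "indicator (disc_class 1 8) x = (of_bool P :: complex)"
    "indicator (disc_class 5 8) x = (of_bool Q :: complex)"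
    by (simp_all add: disc_class_def P_def Q_def indicator_def)
  have r: "hecke 2 (\<lambda>_. 1) x =
      (of_bool (even a) + of_bool (even d) + of_bool (even a = (even b = (even c = even d))) :: complex)"
    unfolding x hecke_tuple_2 by (simp add: of_bool_def) argo
  have L: "x \<in> L5 \<longleftrightarrow> even a \<and> even d \<and> (even b = even c)" "x \<in> Lzero \<longleftrightarrow> even a \<and> even b \<and> even c \<and> even d"
    "x \<in> L2 \<longleftrightarrow> (even b = (even a = even d)) \<and> (even c = (even a = even d))"
    unfolding x lattice_defs by auto
  \<comment> \<open>Truth tables in which the letters stand for the evenness of a, b, c, d; the
    third covers forms without a root modulo 2.\<close>
  have key: "of_bool (A \<and> \<not> B \<and> \<not> C \<and> D) * (of_bool A + of_bool D + of_bool (A = (B = (C = D)))) =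
        (3 * (of_bool (A \<and> D \<and> B = C) - of_bool (A \<and> B \<and> C \<and> D)) :: complex)"
      "of_bool ((B = (A = D)) \<and> (C = (A = D)) \<and> \<not> (A \<and> B \<and> C \<and> D)) * (of_bool A + of_bool D + of_bool (A = (B = (C = D)))) =
        (of_bool ((B = (A = D)) \<and> (C = (A = D))) - of_bool (A \<and> B \<and> C \<and> D) :: complex)"
      "\<not> (A \<or> D \<or> (A = (B = (C = D)))) \<Longrightarrow>
        of_bool A + of_bool D + of_bool (A = (B = (C = D))) = (0::complex)" for A B C D
    by (cases A; cases B; cases C; cases D; simp)+
  have PQ: "P = (even a \<and> odd b \<and> odd c \<and> even d) \<and> Q = ((even b = (even a = even d)) \<and>
      (even c = (even a = even d)) \<and> \<not> (even a \<and> even b \<and> even c \<and> even d))"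
    if "even a \<or> even d \<or> (even a = (even b = (even c = even d)))"
    using f0 f1 f2 f3 f4 that by argo
  have PQr: "of_bool P * hecke 2 (\<lambda>_. 1) x = (of_bool (even a \<and> odd b \<and> odd c \<and> even d) * hecke 2 (\<lambda>_. 1) x :: complex)"
    "of_bool Q * hecke 2 (\<lambda>_. 1) x = (of_bool ((even b = (even a = even d)) \<and>
      (even c = (even a = even d)) \<and> \<not> (even a \<and> even b \<and> even c \<and> even d)) * hecke 2 (\<lambda>_. 1) x :: complex)"
    by (cases "even a \<or> even d \<or> (even a = (even b = (even c = even d)))";
        (simp only: PQ | (drule key(3), simp only: r mult_zero_right)))+
  have "hecke 2 (indicator (disc_class (4*1) 32)) x = (3 * (indicator L5 x - indicator Lzero x) :: complex)"
    unfolding hecke_2_disc_class ind PQr unfolding r key indicator_def L of_bool_def [symmetric] ..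
  thus ?A by simp
  have "hecke 2 (indicator (disc_class (4*5) 32)) x = (indicator L2 x - indicator Lzero x :: complex)"
    unfolding hecke_2_disc_class ind PQr unfolding r key indicator_def L of_bool_def [symmetric] ..
  thus ?B by simp
qed

text \<open>The triple root is the only point that can count towards n: it does so if the value
  there is divisible by 4, and otherwise \<open>disc_triple_root\<close> applies.\<close>

lemma Ltriple_hecke_4:
  assumes "x \<in> Ltriple"
  shows "hecke 4 (\<lambda>_. 1) x = (1::complex) \<or>
    hecke 4 (\<lambda>_. 1) x = (0::complex) \<and> disc x mod 32 = 20"
proof -
  obtain a b c d where x: "x = (a,b,c,d)" by (cases x)
  have nd: "\<not> 4 dvd z" if "odd z" for z :: int using that by presburger
  have m2: "z mod 4 = 2" if "even z" "\<not> 4 dvd z" for z :: int using that by presburger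
  consider "odd a" "even b" "even c" "even d" | "even a" "even b" "even c" "odd d"
    | "odd a" "odd b" "odd c" "odd d"
    using assms unfolding x lattice_defs by auto
  thus ?thesis
  proof cases
    case 1
    hence "hecke 4 (\<lambda>_. 1) x = (of_bool (4 dvd d) :: complex)" unfolding x hecke_4_one by (simp add: nd)
    thus ?thesis using disc_triple_root [of a b c d] m2 [of d] 1 by (auto simp: x)
  next
    case 2
    hence "hecke 4 (\<lambda>_. 1) x = (of_bool (4 dvd a) :: complex)" unfolding x hecke_4_one by (simp add: nd)
    thus ?thesis using disc_triple_root [of d c b a] m2 [of a] 2 by (auto simp: x disc_swap)
  next
    case 3
    hence "hecke 4 (\<lambda>_. 1) x = (of_bool (4 dvd (a+b+c+d)) :: complex)" unfolding x hecke_4_one by (simp add: nd)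
    thus ?thesis
      using disc_triple_root [of d "c+3*d" "b+2*c+3*d" "a+b+c+d"] m2 [of "a+b+c+d"] 3
      by (auto simp: x disc_swap [of d] disc_shift)
  qed
qed

text \<open>The discriminant is even but not divisible by 16, so the form is nonzero modulo 2 with a
  double root. A value 2 modulo 4 there would contradict \<open>disc_double_root\<close>.\<close>

lemma not_Ltriple_hecke_4:
  assumes "x \<notin> Ltriple" "disc x mod 16 = 4"
  shows "hecke 4 (\<lambda>_. 1) x = (1::complex)"
proof -
  obtain a b c d where x: "x = (a,b,c,d)" by (cases x)
  have nd: "\<not> 4 dvd z" if "odd z" for z :: int using that by presburger
  have m2: "z mod 4 = 2" if "even z" "\<not> 4 dvd z" for z :: int using that by presburger
  have "even (disc x)" using assms(2) by presburger
  hence ev: "(odd b \<and> odd c) = (odd a \<and> odd d)" by (simp add: x disc_tuple) blast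
  have nz: "\<not> fdvd 2 x"
  proof
    assume "fdvd 2 x"
    hence "disc x = 16 * disc (fdiv 2 x)" using disc_smul [of 2 "fdiv 2 x"] by (simp add: smul_fdiv)
    thus False using assms(2) by simp
  qed
  \<comment> \<open>The double root is (0,1), then (1,0), and (1,1) in the last two cases.\<close>
  consider "odd b" "even c" "even d" | "odd c" "even a" "even b"
    | "odd a" "even b" "odd c" "even d" | "even a" "odd b" "even c" "odd d"
    using ev nz assms(1) unfolding x lattice_defs by auto
  thus ?thesis
  proof cases
    case 1
    hence "hecke 4 (\<lambda>_. 1) x = (of_bool (4 dvd d) :: complex)" unfolding x hecke_4_one by (simp add: nd)
    thus ?thesis using disc_double_root [of b c d a] m2 [of d] 1 assms(2) by (auto simp: x)
  next
    case 2
    have "\<not> (4 dvd (a+b+c+d) \<and> even (b+d))" using 2 by presburger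
    hence "hecke 4 (\<lambda>_. 1) x = (of_bool (4 dvd a) :: complex)"
      unfolding x hecke_4_one using 2 by (simp add: nd del: even_add)
    thus ?thesis using disc_double_root [of c b a d] m2 [of a] 2 assms(2) by (auto simp: x disc_swap)
  next
    case 3
    hence "hecke 4 (\<lambda>_. 1) x = (of_bool (4 dvd (a+b+c+d)) :: complex)" unfolding x hecke_4_one by (simp add: nd)
    thus ?thesis
      using disc_double_root [of "c+3*d" "b+2*c+3*d" "a+b+c+d" d] m2 [of "a+b+c+d"] 3 assms(2)
      by (auto simp: x disc_swap [of d] disc_shift)
  next
    case 4
    hence "hecke 4 (\<lambda>_. 1) x = (of_bool (4 dvd (a+b+c+d)) :: complex)" unfolding x hecke_4_one by (simp add: nd)
    thus ?thesis
      using disc_double_root [of "c+3*d" "b+2*c+3*d" "a+b+c+d" d] m2 [of "a+b+c+d"] 4 assms(2)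
      by (auto simp: x disc_swap [of d] disc_shift)
  qed
qed

lemma hecke_4_disc_class_4: "x \<in> disc_class 4 32 \<Longrightarrow> hecke 4 (\<lambda>_. 1) x = (1::complex)"
proof -
  assume "x \<in> disc_class 4 32"
  hence d: "disc x mod 32 = 4" by (simp add: disc_class_def)
  hence "disc x mod 16 = 4" using mod_mod_cancel [of 16 32 "disc x"] by simp
  thus ?thesis using Ltriple_hecke_4 [of x] not_Ltriple_hecke_4 [of x] d by auto
qed

text \<open>Where n differs from 1 the two sets coincide. The indicator of the class 20 thus splits
  into n times itself plus (1 - n) times that of \<open>Ltriple\<close>, and the terms with n are
  accessible to the correspondence.\<close>

lemma hecke_4_disc_class_20:
  "indicator (disc_class 20 32) x * (1 - hecke 4 (\<lambda>_. 1) x)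
    = (indicator Ltriple x * (1 - hecke 4 (\<lambda>_. 1) x) :: complex)"
proof (cases "hecke 4 (\<lambda>_. 1) x = (1::complex)")
  case False
  have "disc x mod 32 = 20 \<Longrightarrow> disc x mod 16 = 4"
    using mod_mod_cancel [of 16 32 "disc x"] by simp
  hence "x \<in> disc_class 20 32 \<longleftrightarrow> x \<in> Ltriple"
    using Ltriple_hecke_4 [of x] not_Ltriple_hecke_4 [of x] False by (auto simp: disc_class_def)
  thus ?thesis by (simp add: indicator_def)
qed simp

lemma stable_lattices: "SL2Z_stable L2" "SL2Z_stable L3" "SL2Z_stable L4" "SL2Z_stable L5" "SL2Z_stable Lzero"
proof -
  have par: "odd (p*t - q*r)" if "(p,q,r,t) \<in> SL2Z" for p q r t
    using that by (simp add: SL2Z_def)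
  have "act (p,q,r,t) (a,b,c,d) \<in> X" if "X \<in> {L2,L3,L4,L5,Lzero}" "(a,b,c,d) \<in> X" "(p,q,r,t) \<in> SL2Z"
    for X p q r t a b c d
    using that(1,2) par [OF that(3)] unfolding act_tuple lattice_defs
    by (cases "even p"; cases "even q"; cases "even r"; cases "even t"; force)
  thus "SL2Z_stable L2" "SL2Z_stable L3" "SL2Z_stable L4" "SL2Z_stable L5" "SL2Z_stable Lzero"
    unfolding SL2Z_stable_def by (metis insertCI prod_cases4)+
qed

section \<open>Orbit sums on lattices prime to two\<close>

definition bdd :: "(form \<Rightarrow> complex) \<Rightarrow> bool" where
  "bdd f \<longleftrightarrow> (\<exists>K. \<forall>x. norm (f x) \<le> K)"

lemma bdd_indicator [simp]: "bdd (indicator X)"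
  unfolding bdd_def by (rule exI [of _ 1]) (simp add: indicator_def)

lemma bdd_mult:
  assumes "bdd f" "bdd g"
  shows "bdd (\<lambda>x. f x * g x)"
proof -
  obtain K L where K: "\<And>x. norm (f x) \<le> K" and L: "\<And>x. norm (g x) \<le> L"
    using assms unfolding bdd_def by blast
  have "norm (f x * g x) \<le> K * L" for x
    unfolding norm_mult using K [of x] L [of x] by (intro mult_mono) (auto intro: order_trans [OF norm_ge_zero])
  thus ?thesis unfolding bdd_def by blast
qed

lemma bdd_add:
  assumes "bdd f" "bdd g"
  shows "bdd (\<lambda>x. f x + g x)"
  using assms unfolding bdd_def by (meson add_mono norm_triangle_le)

lemma bdd_cmult: "bdd f \<Longrightarrow> bdd (\<lambda>x. c * f x)"
  by (rule bdd_mult) (auto simp: bdd_def)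

lemma bdd_diff:
  assumes "bdd f" "bdd g"
  shows "bdd (\<lambda>x. f x - g x)"
  using bdd_add [OF assms(1) bdd_cmult [OF assms(2), of "-1"]] by simp

lemma bdd_hecke_4: "bdd (hecke 4 (\<lambda>_. 1))"
proof -
  have "norm (hecke 4 (\<lambda>_. 1) x :: complex) \<le> (\<Sum>i<(3::nat). 1)" for x
    unfolding hecke_def by (intro sum_norm_le) auto
  thus ?thesis unfolding bdd_def by blast
qed

lemmas bdd_intros = bdd_indicator bdd_mult bdd_add bdd_diff bdd_cmult bdd_hecke_4

lemma summable_on_mass:
  assumes "1 < Re s" "bdd f"
  shows "(\<lambda>C. f (rep C) * wt s C) summable_on classes j"
proof -
  obtain K where K: "\<And>x. norm (f x) \<le> K" using assms unfolding bdd_def by blast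
  have "(\<lambda>C. norm (f (rep C) * wt s C)) summable_on classes j"
  proof (rule summable_on_comparison_test)
    show "(\<lambda>C. K * norm (wt s C)) summable_on classes j"
      using summable_on_wt [OF assms(1)] by (rule summable_on_cmult_right)
    show "norm (f (rep C) * wt s C) \<le> K * norm (wt s C)" for C
      unfolding norm_mult by (rule mult_right_mono [OF K norm_ge_zero])
  qed simp
  thus ?thesis by (rule abs_summable_summable)
qed

lemma mass_add:
  assumes "1 < Re s" "bdd f" "bdd g"
  shows "mass j s (\<lambda>x. f x + g x) = mass j s f + mass j s g"
  unfolding mass_def using summable_on_mass assms by (simp add: distrib_right infsum_add)

lemma mass_cmult: "mass j s (\<lambda>x. c * f x) = c * mass j s f"
  unfolding mass_def by (simp add: mult.assoc infsum_cmult_right')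

lemma mass_diff:
  assumes "1 < Re s" "bdd f" "bdd g"
  shows "mass j s (\<lambda>x. f x - g x) = mass j s f - mass j s g"
  using mass_add [OF assms(1,2) bdd_cmult [OF assms(3), of "-1"], of j] mass_cmult [of j s "-1" g] by simp

text \<open>Models a congruence condition away from 2, such as the one modulo 3 in
  \<open>L1v\<close>. The scalar 2 appears in the correspondence itself, and 8 in its composition
  with the adjugate.\<close>

definition prime_to_two :: "form set \<Rightarrow> bool" where
  "prime_to_two M \<longleftrightarrow> (\<forall>x\<in>M. \<forall>g. act g x \<in> M) \<and> (\<forall>x. \<forall>k\<in>{2,8}. smul k x \<in> M \<longleftrightarrow> x \<in> M)"

lemma stable_Int: "SL2Z_stable X \<Longrightarrow> SL2Z_stable Y \<Longrightarrow> SL2Z_stable (X \<inter> Y)"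
  by (simp add: SL2Z_stable_def)

lemma stable_iff:
  assumes "SL2Z_stable X" "g \<in> SL2Z"
  shows "act g x \<in> X \<longleftrightarrow> x \<in> X"
proof
  assume "act g x \<in> X"
  hence "act (madj g) (act g x) \<in> X" using assms SL2Z_madj by (simp add: SL2Z_stable_def)
  thus "x \<in> X" using act_inverse [OF assms(2), of x "act g x"] by simp
qed (use assms in \<open>simp add: SL2Z_stable_def\<close>)

lemma stable_Diff: "SL2Z_stable X \<Longrightarrow> SL2Z_stable Y \<Longrightarrow> SL2Z_stable (X - Y)"
  using stable_iff unfolding SL2Z_stable_def by blast

lemma invariant_indicator: "SL2Z_stable X \<Longrightarrow> SL2Z_invariant (indicator X :: form \<Rightarrow> complex)"
  unfolding SL2Z_invariant_def indicator_def by (simp add: stable_iff)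

lemma stable_Ltriple: "SL2Z_stable Ltriple"
  unfolding Ltriple_def by (intro stable_Diff stable_lattices)

lemma stable_disc_class: "SL2Z_stable (disc_class l N)"
  unfolding SL2Z_stable_def disc_class_def by (simp add: disc_act_SL2Z)

lemma prime_to_two_stable: "prime_to_two M \<Longrightarrow> SL2Z_stable M"
  unfolding prime_to_two_def SL2Z_stable_def by blast

text \<open>The map and its adjugate both preserve \<open>M\<close>, so a reached form lies in
  \<open>M\<close> exactly when x does.\<close>

lemma hecke_indicator_Int:
  assumes "prime_to_two M"
  shows "hecke 2 (indicator (M \<inter> X)) x = (indicator M x * hecke 2 (indicator X) x :: complex)"
proof -
  have "y \<in> M \<longleftrightarrow> x \<in> M" if y: "act (hecke_rep i) x = smul 2 y" for i y
  proof
    assume "x \<in> M"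
    thus "y \<in> M" using assms y unfolding prime_to_two_def by (metis insertI1)
  next
    assume "y \<in> M"
    hence "act (madj (hecke_rep i)) (act (hecke_rep i) x) \<in> M"
      using assms y unfolding prime_to_two_def by (metis insertI1)
    hence "smul 8 x \<in> M" by (simp add: act_mm [symmetric] act_mm_madj)
    thus "x \<in> M" using assms unfolding prime_to_two_def by blast
  qed
  hence "fdvd 2 (act (hecke_rep i) x) \<Longrightarrow> fdiv 2 (act (hecke_rep i) x) \<in> M \<longleftrightarrow> x \<in> M" for i
    by (metis smul_fdiv)
  thus ?thesis unfolding hecke_def sum_distrib_left
    by (intro sum.cong) (auto simp: indicator_def)
qed

lemma mass_Int_Lzero:
  assumes M: "prime_to_two M"
  shows "mass j s (indicator (M \<inter> Lzero)) = 16 powr (-s) * mass j s (indicator M)"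
proof -
  have "x \<in> M \<longleftrightarrow> fdiv 2 x \<in> M" if "fdvd 2 x" for x
    using M smul_fdiv [OF that] unfolding prime_to_two_def by (metis insertI1)
  hence "indicator (M \<inter> Lzero) = (\<lambda>x. if fdvd 2 x then indicator M (fdiv 2 x) else 0 :: complex)"
    by (auto simp: indicator_def Lzero_def fun_eq_iff)
  thus ?thesis
    using mass_even_forms [OF invariant_indicator [OF prime_to_two_stable [OF M]]] by simp
qed

lemma mass_hecke_indicator:
  assumes M: "prime_to_two M" and s: "1 < Re s" and X: "SL2Z_stable X"
  shows "mass j s (\<lambda>x. indicator (M \<inter> X) x * hecke 4 (\<lambda>_. 1) x)
    = 4 powr (-s) * mass j s (\<lambda>x. indicator M x * hecke 2 (indicator X) x)"
proof -
  have "SL2Z_invariant (indicator (M \<inter> X) :: form \<Rightarrow> complex)"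
    by (intro invariant_indicator stable_Int prime_to_two_stable M X)
  hence "mass j s (hecke 2 (indicator (M \<inter> X))) = 4 powr s * mass j s (\<lambda>x. indicator (M \<inter> X) x * hecke 4 (\<lambda>_. 1) x)"
    by (rule mass_hecke [OF s, where K = 1]) (simp add: indicator_def)
  moreover have "hecke 2 (indicator (M \<inter> X)) = (\<lambda>x. indicator M x * hecke 2 (indicator X) x :: complex)"
    using hecke_indicator_Int [OF M] by blast
  ultimately show ?thesis by (simp add: powr_minus)
qed

text \<open>On this class n is 1, so n may be inserted for free and the correspondence applies
  directly.\<close>

lemma mass_disc_class_4:
  assumes M: "prime_to_two M" and s: "1 < Re s"
  shows "mass j s (indicator (M \<inter> disc_class 4 32)) =
    3 * 4 powr (-s) * (mass j s (indicator (M \<inter> L5)) - 16 powr (-s) * mass j s (indicator M))"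
proof -
  have "indicator (M \<inter> disc_class 4 32) = (\<lambda>x. indicator (M \<inter> disc_class 4 32) x * hecke 4 (\<lambda>_. 1) x :: complex)"
    using hecke_4_disc_class_4 by (auto simp: indicator_def fun_eq_iff)
  hence "mass j s (indicator (M \<inter> disc_class 4 32)) =
      4 powr (-s) * mass j s (\<lambda>x. indicator M x * hecke 2 (indicator (disc_class 4 32)) x)"
    using mass_hecke_indicator [OF M s stable_disc_class] by metis
  also have "(\<lambda>x. indicator M x * hecke 2 (indicator (disc_class 4 32)) x) =
      (\<lambda>x. 3 * (indicator (M \<inter> L5) x - indicator (M \<inter> Lzero) x) :: complex)"
    unfolding hecke_2_disc_class_4_20 by (simp add: indicator_inter_arith algebra_simps)
  also have "mass j s \<dots> = 3 * (mass j s (indicator (M \<inter> L5)) - mass j s (indicator (M \<inter> Lzero)))"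
    by (simp add: mass_cmult mass_diff s bdd_intros)
  finally show ?thesis by (simp add: mass_Int_Lzero M)
qed

text \<open>The correspondence is applied to the class 20, to \<open>Ltriple\<close> and to all of
  \<open>M\<close>. The second application leaves a term with n, which the third evaluates; hence
  the nested \<open>q\<close>.\<close>

lemma mass_disc_class_20:
  fixes j :: nat
  assumes M: "prime_to_two M" and s: "1 < Re s"
  defines "m \<equiv> \<lambda>X. mass j s (indicator (M \<inter> X))"
    and "q \<equiv> 4 powr (-s)" and "z \<equiv> 16 powr (-s) * mass j s (indicator M)"
    and "m1 \<equiv> mass j s (indicator M)"
  shows "m (disc_class 20 32) = (m L4 - m L2 - m L5 + z) + q * (m L2 - z)
     - q * (m1 - m L2 - m L3 + 4 * z - q * (2 * m1 - 2 * m L3 - m L4 + 4 * m L5))"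
proof -
  let ?n = "hecke 4 (\<lambda>_. 1) :: form \<Rightarrow> complex"
  have mX: "mass j s (indicator (M \<inter> X)) = m X" for X by (simp add: m_def)
  have z: "m Lzero = z" unfolding m_def z_def by (rule mass_Int_Lzero [OF M])
  have "indicator (M \<inter> disc_class 20 32) = (\<lambda>x. indicator (M \<inter> disc_class 20 32) x * ?n x
      + (indicator (M \<inter> Ltriple) x - indicator (M \<inter> Ltriple) x * ?n x))"
  proof
    fix x
    show "indicator (M \<inter> disc_class 20 32) x = indicator (M \<inter> disc_class 20 32) x * ?n x
      + (indicator (M \<inter> Ltriple) x - indicator (M \<inter> Ltriple) x * ?n x)"
      using hecke_4_disc_class_20 [of x] unfolding indicator_inter_arith by algebra
  qed
  hence "m (disc_class 20 32) = mass j s (\<lambda>x. indicator (M \<inter> disc_class 20 32) x * ?n x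
      + (indicator (M \<inter> Ltriple) x - indicator (M \<inter> Ltriple) x * ?n x))"
    unfolding m_def by (rule arg_cong)
  also have "\<dots> = mass j s (\<lambda>x. indicator (M \<inter> disc_class 20 32) x * ?n x)
      + (m Ltriple - mass j s (\<lambda>x. indicator (M \<inter> Ltriple) x * ?n x))"
    unfolding m_def by (simp add: mass_add mass_diff s bdd_intros)
  also have "mass j s (\<lambda>x. indicator (M \<inter> disc_class 20 32) x * ?n x) = q * (m L2 - z)"
  proof -
    have "(\<lambda>x. indicator M x * hecke 2 (indicator (disc_class 20 32)) x) =
        (\<lambda>x. indicator (M \<inter> L2) x - indicator (M \<inter> Lzero) x :: complex)"
      unfolding hecke_2_disc_class_4_20 by (simp add: indicator_inter_arith algebra_simps)
    thus ?thesis
      by (simp add: mass_hecke_indicator [OF M s stable_disc_class] mass_diff s bdd_intros q_def mX z)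
  qed
  also have "mass j s (\<lambda>x. indicator (M \<inter> Ltriple) x * ?n x) =
      q * (m1 - m L2 - m L3 + 4 * z - mass j s (\<lambda>x. indicator M x * ?n x))"
  proof -
    have "(\<lambda>x. indicator M x * hecke 2 (indicator Ltriple) x) =
        (\<lambda>x. indicator M x - indicator (M \<inter> L2) x - indicator (M \<inter> L3) x + 4 * indicator (M \<inter> Lzero) x
           - indicator M x * ?n x)"
      unfolding hecke_2_Ltriple by (simp add: indicator_inter_arith algebra_simps)
    thus ?thesis
      by (simp add: mass_hecke_indicator [OF M s stable_Ltriple] mass_diff mass_add mass_cmult s bdd_intros
          q_def mX m1_def z)
  qed
  also have "mass j s (\<lambda>x. indicator M x * ?n x) = q * (2 * m1 - 2 * m L3 - m L4 + 4 * m L5)"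
  proof -
    have st: "SL2Z_stable UNIV" by (simp add: SL2Z_stable_def)
    have u: "(indicator UNIV :: form \<Rightarrow> complex) = (\<lambda>_. 1)" by auto
    have "(\<lambda>x. indicator M x * hecke 2 (\<lambda>_. 1) x) =
        (\<lambda>x. 2 * indicator M x - 2 * indicator (M \<inter> L3) x - indicator (M \<inter> L4) x + 4 * indicator (M \<inter> L5) x :: complex)"
      unfolding hecke_2_one by (simp add: indicator_inter_arith algebra_simps)
    thus ?thesis using mass_hecke_indicator [OF M s st, of j]
      by (simp add: u mass_diff mass_add mass_cmult s bdd_intros q_def mX m1_def)
  qed
  also have "m Ltriple = m L4 - m L2 - m L5 + z"
  proof -
    have "indicator (M \<inter> Ltriple) = (\<lambda>x. indicator (M \<inter> L4) x - indicator (M \<inter> L2) x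
        - indicator (M \<inter> L5) x + indicator (M \<inter> Lzero) x :: complex)"
      by (simp add: fun_eq_iff indicator_inter_arith indicator_Ltriple algebra_simps)
    thus ?thesis unfolding z [symmetric]
      unfolding m_def by (simp add: mass_diff mass_add s bdd_intros)
  qed
  finally show ?thesis by (simp add: algebra_simps)
qed

section \<open>Specialization to the full lattice and its dual\<close>

lemma prime_to_two_UNIV: "prime_to_two UNIV"
  by (simp add: prime_to_two_def)

lemma prime_to_two_L1v: "prime_to_two L1v"
proof -
  have "act (p,q,r,t) (a,b,c,d) \<in> L1v" if "(a,b,c,d) \<in> L1v" for p q r t a b c d
    using that unfolding L1v_def act_tuple by (auto intro!: dvd_add dvd_mult2 simp: mult.assoc)
  moreover have "smul k (a,b,c,d) \<in> L1v \<longleftrightarrow> (a,b,c,d) \<in> L1v" if "k \<in> {2,8}" for k a b c d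
    using that unfolding L1v_def smul.simps by simp presburger
  ultimately show ?thesis unfolding prime_to_two_def by (metis prod_cases4)
qed

text \<open>On \<open>L1v\<close> the discriminant is divisible by 27, so the division is exact.
  Modulo 32 the inverse of 27 is 19, and multiplication by 27 takes -20 to 4 and -4 to 20.\<close>

lemma L1v_cong_eq:
  assumes "(l, m) \<in> {(-20, 4), (-4, 20)}"
  shows "L1v_cong l 32 = L1v \<inter> disc_class m 32"
proof -
  have "disc x div 27 mod 32 = l mod 32 \<longleftrightarrow> disc x mod 32 = m" if x: "x \<in> L1v" for x
  proof -
    obtain a b c d where e: "x = (a,b,c,d)" by (cases x)
    obtain b' c' where bc: "b = 3*b'" "c = 3*c'" using x unfolding e L1v_def by (auto elim!: dvdE)
    have "disc x = 27 * (3*b'^2*c'^2 + 6*a*b'*c'*d - 4*a*c'^3 - 4*b'^3*d - a^2*d^2)"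
      unfolding e bc disc_tuple by algebra
    then obtain D where D: "disc x = 27 * D" by blast
    have 1: "27 * D mod 32 = 27 * (D mod 32) mod 32" by (simp add: mod_mult_right_eq)
    have "19 * (27 * D) = D + 32 * (16 * D)" by simp
    hence 2: "D mod 32 = 19 * (27 * D mod 32) mod 32" by (metis mod_mult_right_eq mod_mult_self2)
    from assms show ?thesis unfolding D using 1 2 by auto
  qed
  thus ?thesis unfolding L1v_cong_def disc_class_def by blast
qed

text \<open>With every power written through \<open>2 powr (-2* s)\<close>, comparing the two forms
  of an identity is polynomial algebra.\<close>

lemma powr_conversions:
  fixes s :: complex
  shows "4 powr (-s) = 2 powr (-2* s)" "16 powr (-s) = 2 powr (-2* s) * 2 powr (-2* s)"
    "2 powr (-4* s) = 2 powr (-2* s) * 2 powr (-2* s)"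
    "2 powr (1 - 4* s) = 2 * (2 powr (-2* s) * 2 powr (-2* s))"
proof -
  have 2: "(2::complex) powr (-2* s) = 2 powr (-s) * 2 powr (-s)"
    using powr_add [of "2::complex" "-s" "-s"] by simp
  have "(2 * 2 :: complex) powr (-s) = 2 powr (-s) * 2 powr (-s)"
    by (rule powr_times_real_left) simp_all
  thus 4: "4 powr (-s) = 2 powr (-2* s)" unfolding 2 by simp
  have "(4 * 4 :: complex) powr (-s) = 4 powr (-s) * 4 powr (-s)"
    by (rule powr_times_real_left) simp_all
  thus "16 powr (-s) = 2 powr (-2* s) * 2 powr (-2* s)" unfolding 4 by simp
  show 16: "(2::complex) powr (-4* s) = 2 powr (-2* s) * 2 powr (-2* s)"
    using powr_add [of "2::complex" "-2* s" "-2* s"] by simp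
  show "(2::complex) powr (1 - 4* s) = 2 * (2 powr (-2* s) * 2 powr (-2* s))"
    using powr_add [of "2::complex" 1 "-4* s"] 16 by simp
qed

lemma xi_Int_eq_mass:
  "prime_to_two M \<Longrightarrow> SL2Z_stable X \<Longrightarrow> xi (M \<inter> X) j s = mass j s (indicator (M \<inter> X))"
  by (simp add: xi_eq_mass stable_Int prime_to_two_stable)

lemma xi_disc_class_4:
  assumes M: "prime_to_two M" and s: "1 < Re s"
  shows "xi (M \<inter> disc_class 4 32) j s
    = 3 * 2 powr (-2* s) * (xi (M \<inter> L5) j s - 2 powr (-4* s) * xi M j s)"
  using mass_disc_class_4 [OF M s, of j]
  unfolding xi_Int_eq_mass [OF M stable_lattices(4)] xi_Int_eq_mass [OF M stable_disc_class]
    xi_eq_mass [OF prime_to_two_stable [OF M]] powr_conversions .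

lemma xi_disc_class_20:
  assumes M: "prime_to_two M" and s: "1 < Re s"
  shows "xi (M \<inter> disc_class 20 32) j s
    = (xi (M \<inter> L4) j s - xi (M \<inter> L2) j s - xi (M \<inter> L5) j s + 2 powr (1 - 4* s) * xi M j s)
      + 2 powr (-4* s) * (xi M j s - xi (M \<inter> L4) j s - 2 * xi (M \<inter> L3) j s + 4 * xi (M \<inter> L5) j s)
      - 2 powr (-2* s) * (xi M j s - xi (M \<inter> L3) j s - 2 * xi (M \<inter> L2) j s
                         + 5 * 2 powr (-4* s) * xi M j s)"
  using mass_disc_class_20 [OF M s, of j]
  unfolding stable_lattices(1-4) [THEN xi_Int_eq_mass [OF M]] xi_Int_eq_mass [OF M stable_disc_class]
    xi_eq_mass [OF prime_to_two_stable [OF M]] powr_conversions by algebra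

theorem theorem3p8:
  fixes s :: complex and j :: nat
  assumes "1 < Re s" and "j \<in> {1, 2}"
  shows
   "xi (L1_cong 4 32) j s
      = 3 * 2 powr (-2* s) * (xi L5 j s - 2 powr (-4* s) * xi L1 j s)
    \<and> xi_dual (L1v_cong (-20) 32) j s
      = 3 * 2 powr (-2* s) * (xi_dual L4v j s - 2 powr (-4* s) * xi_dual L1v j s)
    \<and> xi (L1_cong 20 32) j s
      = (xi L4 j s - xi L2 j s - xi L5 j s + 2 powr (1 - 4* s) * xi L1 j s)
        + 2 powr (-4* s) * (xi L1 j s - xi L4 j s - 2 * xi L3 j s + 4 * xi L5 j s)
        - 2 powr (-2* s) * (xi L1 j s - xi L3 j s - 2 * xi L2 j s
                           + 5 * 2 powr (-4* s) * xi L1 j s)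
    \<and> xi_dual (L1v_cong (-4) 32) j s
      = (xi_dual L5v j s - xi_dual L3v j s - xi_dual L4v j s
           + 2 powr (1 - 4* s) * xi_dual L1v j s)
        + 2 powr (-4* s) * (xi_dual L1v j s - xi_dual L5v j s - 2 * xi_dual L2v j s
                           + 4 * xi_dual L4v j s)
        - 2 powr (-2* s) * (xi_dual L1v j s - xi_dual L2v j s - 2 * xi_dual L3v j s
                           + 5 * 2 powr (-4* s) * xi_dual L1v j s)"
proof -
  have L1: "L1_cong 4 32 = UNIV \<inter> disc_class 4 32" "L1_cong 20 32 = UNIV \<inter> disc_class 20 32"
    by (simp_all add: L1_cong_def disc_class_def L1_def)
  have L1v: "L1v_cong (-20) 32 = L1v \<inter> disc_class 4 32" "L1v_cong (-4) 32 = L1v \<inter> disc_class 20 32"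
    by (simp_all add: L1v_cong_eq)
  \<comment> \<open>The dual identities are those for \<open>L1v\<close>, multiplied by the common
    normalizing power of 3. The definitions of the dual lattices exchange the indices 2 with 3 and 4
    with 5.\<close>
  show ?thesis
    using xi_disc_class_4 [OF prime_to_two_UNIV assms(1), of j]
      xi_disc_class_20 [OF prime_to_two_UNIV assms(1), of j]
    unfolding L1 L1v xi_dual_def L2v_def L3v_def L4v_def L5v_def L1_def
      xi_disc_class_4 [OF prime_to_two_L1v assms(1)] xi_disc_class_20 [OF prime_to_two_L1v assms(1)]
    by (simp add: algebra_simps)
qed

end
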